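(* Let $d>0$ and let $\Omega=\{(x_1,x_2)\in\mathbb R^2:\ x_1\neq0\ \text{ or }\ x_2\in(-d,d)\}$ be the aperture domain. There exists $\Phi_0>0$ such that for every $\Phi\in(-\Phi_0,\Phi_0)$ with $\Phi\ne0$, the unique Galdi--Padula--Solonnikov solution $\boldsymbol u$ (recalled in the context) of the steady Navier--Stokes equations in $\Omega$ with $\boldsymbol u=0$ on $\partial\Omega$ and flux $\Phi=\int_{-d}^{d}u_1(0,x_2)\,dx_2$ has the following behavior: its leading order term at the upstream is a self-similar solution of type $(0,1)$, while its leading order term at the downstream is a self-similar solution of type $(1,2)$.
   Context: The steady Navier--Stokes equations are $-\Delta\boldsymbol u+\boldsymbol u\cdot\nabla\boldsymbol u+\nabla p=0$, $\operatorname{div}\boldsymbol u=0$. Let $H_\pm=\{x\in\mathbb R^2:\pm x_1>0\}$. In $H_\pm$ use polar coordinates $(r,\theta)$, $\theta\in(-\frac{\pi}{2},\frac{\pi}{2})$, where $\theta=0$ is the positive $x_1$-axis for $H_+$ and the negative $x_1$-axis for $H_-$, and $\boldsymbol e_r=x/|x|$. Self-similar solutions and types: a solution of the Navier--Stokes equations in $H_\pm$ vanishing on $\partial H_\pm\setminus\{0\}$ is self-similar if $\boldsymbol u(x)=\lambda\boldsymbol u(\lambda x)$, $p(x)=\lambda^2p(\lambda x)$ for all $\lambda>0$; it then has the form $\boldsymbol u=\frac{f(\theta)}{r}\boldsymbol e_r$ with $f(\pm\frac{\pi}{2})=0$. If it is non-trivial, it is of type $(m_+,m_-)$ if the number of (maximal)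 intervals of $\theta\in(-\frac{\pi}{2},\frac{\pi}{2})$ where $f>0$ is $m_+$ and the number where $f<0$ is $m_-$. Known results of Galdi, Padula and Solonnikov (to be used as given). (i) If $|\Psi|<\frac1{36}$, there exists a unique $f$ such that $\frac{f(\theta)}{r}\boldsymbol e_r$ solves the Navier--Stokes equations in the half-plane $H=H_\pm$ with $\int_{-\pi/2}^{\pi/2}f\,d\theta=\Psi$, $f(\pm\frac{\pi}{2})=0$, $f(\theta)=f(-\theta)$ and $\max_{[-\pi/2,\pi/2]}|f|\le6|\Psi|$; it is called the Jeffery--Hamel solution in $H$ with flux $\Psi$. (ii) There exists $\Phi_1>0$ such that if $|\Phi|<\Phi_1$ there is a solution $\boldsymbol u\in W^{1,2}_{loc}(\overline\Omega)$, $\nabla\boldsymbol u\in L^2(\Omega)$, of the Navier--Stokes equations in $\Omega$ with $\boldsymbol u=0$ on $\partial\Omega$, $\int_{-d}^{d}u_1(0,x_2)\,dx_2=\Phi$, $\lim_{|x|\to\infty}\boldsymbol u(x)=0$, symmetric in the sense that $u_1(x_1,-x_2)=u_1(x_1,x_2)$, $u_2(x_1,-x_2)=-u_2(x_1,x_2)$, and such that for $\sigma\in(0,1)$ and $R>2d$, $\sup_{x\in\Omega,\,|x|>R}|x|^{1+\sigma}|\boldsymbol u(x)-\bar{\boldsymbol u}(x)|\le c(\sigma,R)|\Phi|<\infty$, where $\bar{\boldsymbol u}=\bar{\boldsymbol u}_\pm$ in $H_\pm$ and $\bar{\boldsymbol u}_\pm$ is the Jeffery--Hamel solution in $H_\pm$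 with flux $\pm\Phi$. For small flux this solution is unique; it is the solution $\boldsymbol u$ in the claim. The self-similar fields $\bar{\boldsymbol u}_\pm$ are the leading order terms of $\boldsymbol u$ in $H_\pm$. Upstream and downstream: for $\Phi>0$ the upstream is the region $x_1\to-\infty$ (leading order term $\bar{\boldsymbol u}_-$) and the downstream is the region $x_1\to+\infty$ (leading order term $\bar{\boldsymbol u}_+$); for $\Phi<0$ these two regions are interchanged. *)

theory Defs
  imports "HOL-Analysis.Analysis"
begin

section \<open>Differential operators in the plane\<close>

definition pd :: "2 \<Rightarrow> (real^2 \<Rightarrow> real) \<Rightarrow> real^2 \<Rightarrow> real" where
  "pd i g x = frechet_derivative g (at x) (axis i 1)"

text \<open>Class \<open>C\<^sup>k\<close>; the intended sets \<open>S\<close> are open.\<close>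

fun Ck_on :: "nat \<Rightarrow> (real^2 \<Rightarrow> real) \<Rightarrow> (real^2) set \<Rightarrow> bool" where
  "Ck_on 0 g S \<longleftrightarrow> continuous_on S g"
| "Ck_on (Suc k) g S \<longleftrightarrow> (\<forall>x\<in>S. g differentiable (at x)) \<and> (\<forall>i. Ck_on k (pd i g) S)"

definition navier_stokes :: "(real^2) set \<Rightarrow> (real^2 \<Rightarrow> real^2) \<Rightarrow> (real^2 \<Rightarrow> real) \<Rightarrow> bool" where
  "navier_stokes S u p \<longleftrightarrow>
     (\<forall>i. Ck_on 2 (\<lambda>y. u y $ i) S) \<and> Ck_on 1 p S \<and>
     (\<forall>x\<in>S. \<forall>i. - (\<Sum>j\<in>UNIV. pd j (pd j (\<lambda>y. u y $ i)) x)
                  + (\<Sum>j\<in>UNIV. u x $ j * pd j (\<lambda>y. u y $ i) x) + pd i p x = 0) \<and>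
     (\<forall>x\<in>S. (\<Sum>i\<in>UNIV. pd i (\<lambda>y. u y $ i) x) = 0)"

definition grad_sq :: "(real^2 \<Rightarrow> real^2) \<Rightarrow> real^2 \<Rightarrow> real" where
  "grad_sq w x = (\<Sum>i\<in>UNIV. \<Sum>j\<in>UNIV. (pd i (\<lambda>y. w y $ j) x)\<^sup>2)"

text \<open>The square of the \<open>W\<^sup>1\<^sup>,\<^sup>2(A)\<close> norm, for fields that are differentiable on the open
  set \<open>A\<close>, so that classical and weak derivatives agree.\<close>

definition sobolev_norm_sq :: "(real^2) set \<Rightarrow> (real^2 \<Rightarrow> real^2) \<Rightarrow> ennreal" where
  "sobolev_norm_sq A w = (\<integral>\<^sup>+x\<in>A. ennreal ((norm (w x))\<^sup>2 + grad_sq w x) \<partial>lborel)"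

definition test_field :: "(real^2) set \<Rightarrow> (real^2 \<Rightarrow> real^2) \<Rightarrow> bool" where
  "test_field A \<phi> \<longleftrightarrow>
     (\<forall>k i. Ck_on k (\<lambda>y. \<phi> y $ i) UNIV) \<and>
     compact (closure {x. \<phi> x \<noteq> 0}) \<and> closure {x. \<phi> x \<noteq> 0} \<subseteq> A"

text \<open>Zero trace on the boundary of \<open>A\<close> for a field in \<open>W\<^sup>1\<^sup>,\<^sup>2(A \<inter> B\<^sub>R)\<close> for all \<open>R\<close>:
  local approximation by fields in \<open>C\<^sub>c\<^sup>\<infinity>(A)\<close>. Equivalently, \<open>\<chi> w\<close> lies in the
  \<open>W\<^sup>1\<^sup>,\<^sup>2\<close>-closure of \<open>C\<^sub>c\<^sup>\<infinity>(A)\<close> for every smooth compactly supported cut-off \<open>\<chi>\<close> on the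
  plane. If \<open>A\<close> lies on both sides of its boundary, both one-sided traces vanish.\<close>

definition zero_trace :: "(real^2) set \<Rightarrow> (real^2 \<Rightarrow> real^2) \<Rightarrow> bool" where
  "zero_trace A w \<longleftrightarrow>
     (\<forall>R>0. \<forall>e>0. \<exists>\<phi>. test_field A \<phi> \<and>
        sobolev_norm_sq (A \<inter> ball 0 R) (\<lambda>x. w x - \<phi> x) < ennreal e)"

section \<open>Self-similar solutions in half-planes\<close>

text \<open>The half-plane \<open>H\<^sub>+\<close> is encoded by \<open>s = 1\<close> and \<open>H\<^sub>-\<close> by \<open>s = -1\<close>.\<close>

definition half_plane :: "real \<Rightarrow> (real^2) set" where
  "half_plane s = {x. s * x $ 1 > 0}"

text \<open>In \<open>H\<^sub>-\<close> the angle is measured counterclockwise from the negative first axis. The opposite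
  orientation would replace \<open>f \<theta>\<close> by \<open>f (-\<theta>)\<close> below, which affects neither types nor
  the Jeffery--Hamel conditions.\<close>

definition polar :: "real \<Rightarrow> real \<Rightarrow> real \<Rightarrow> real^2" where
  "polar s r \<theta> = (s * r) *\<^sub>R vector [cos \<theta>, sin \<theta>]"

text \<open>The field \<open>v\<close> is \<open>(f(\<theta>) / r) e\<^sub>r\<close> on the closed half-plane without the origin.\<close>

definition radial_field :: "real \<Rightarrow> (real \<Rightarrow> real) \<Rightarrow> (real^2 \<Rightarrow> real^2) \<Rightarrow> bool" where
  "radial_field s f v \<longleftrightarrow>
     (\<forall>r>0. \<forall>\<theta>\<in>{- pi/2 .. pi/2}. v (polar s r \<theta>) = (f \<theta> / r) *\<^sub>R polar s 1 \<theta>)"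

definition self_similar_solution ::
    "real \<Rightarrow> (real^2 \<Rightarrow> real^2) \<Rightarrow> (real^2 \<Rightarrow> real) \<Rightarrow> bool" where
  "self_similar_solution s v p \<longleftrightarrow>
     navier_stokes (half_plane s) v p \<and>
     continuous_on (closure (half_plane s) - {0}) v \<and>
     (\<forall>x \<in> frontier (half_plane s) - {0}. v x = 0) \<and>
     (\<forall>l>0. \<forall>x \<in> half_plane s. v x = l *\<^sub>R v (l *\<^sub>R x) \<and> p x = l\<^sup>2 * p (l *\<^sub>R x))"

text \<open>The maximal intervals on which \<open>f\<close> has a given sign are the connected components of the
  corresponding subset of the open interval.\<close>

definition self_similar_of_type :: "real \<Rightarrow> (real^2 \<Rightarrow> real^2) \<Rightarrow> nat \<times> nat \<Rightarrow> bool" where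
  "self_similar_of_type s v m \<longleftrightarrow>
     (\<exists>p. self_similar_solution s v p) \<and>
     (\<exists>f. radial_field s f v \<and> f (- pi/2) = 0 \<and> f (pi/2) = 0 \<and>
        (\<exists>\<theta> \<in> {- pi/2 <..< pi/2}. f \<theta> \<noteq> 0) \<and>
        finite (components {\<theta> \<in> {- pi/2 <..< pi/2}. f \<theta> > 0}) \<and>
        card (components {\<theta> \<in> {- pi/2 <..< pi/2}. f \<theta> > 0}) = fst m \<and>
        finite (components {\<theta> \<in> {- pi/2 <..< pi/2}. f \<theta> < 0}) \<and>
        card (components {\<theta> \<in> {- pi/2 <..< pi/2}. f \<theta> < 0}) = snd m)"

definition jeffery_hamel :: "real \<Rightarrow> real \<Rightarrow> (real^2 \<Rightarrow> real^2) \<Rightarrow> bool" where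
  "jeffery_hamel s \<Psi> v \<longleftrightarrow>
     (\<exists>p. navier_stokes (half_plane s) v p) \<and>
     (\<exists>f. radial_field s f v \<and> continuous_on {- pi/2 .. pi/2} f \<and>
        (f has_integral \<Psi>) {- pi/2 .. pi/2} \<and>
        f (- pi/2) = 0 \<and> f (pi/2) = 0 \<and>
        (\<forall>\<theta> \<in> {- pi/2 .. pi/2}. f (- \<theta>) = f \<theta>) \<and>
        (\<forall>\<theta> \<in> {- pi/2 .. pi/2}. \<bar>f \<theta>\<bar> \<le> 6 * \<bar>\<Psi>\<bar>))"

section \<open>Flow through an aperture\<close>

definition aperture :: "real \<Rightarrow> (real^2) set" where
  "aperture d = {x. x $ 1 \<noteq> 0 \<or> x $ 2 \<in> {- d <..< d}}"

text \<open>The Galdi--Padula--Solonnikov solution with flux \<open>\<Phi>\<close>. Steady Navier--Stokes solutions of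
  class \<open>W\<^sup>1\<^sup>,\<^sup>2\<close> are smooth in the interior, and \<open>u\<close> denotes the smooth representative. The
  boundary condition is the zero trace. Since the complement of the domain is its boundary,
  the pointwise condition \<open>u x = 0\<close> there fixes \<open>u\<close> as a function on the whole plane.\<close>

definition gps_solution :: "real \<Rightarrow> real \<Rightarrow> (real^2 \<Rightarrow> real^2) \<Rightarrow> bool" where
  "gps_solution d \<Phi> u \<longleftrightarrow>
     (\<exists>p. navier_stokes (aperture d) u p) \<and>
     (\<forall>R>0. sobolev_norm_sq (aperture d \<inter> ball 0 R) u < \<infinity>) \<and>
     (\<integral>\<^sup>+x\<in>aperture d. ennreal (grad_sq u x) \<partial>lborel) < \<infinity> \<and>
     zero_trace (aperture d) u \<and> (\<forall>x \<in> frontier (aperture d). u x = 0) \<and>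
     ((\<lambda>t. u (vector [0, t]) $ 1) has_integral \<Phi>) {- d .. d} \<and>
     (u \<longlongrightarrow> 0) at_infinity \<and>
     (\<forall>x1 x2. u (vector [x1, - x2]) $ 1 = u (vector [x1, x2]) $ 1 \<and>
              u (vector [x1, - x2]) $ 2 = - u (vector [x1, x2]) $ 2) \<and>
     (\<forall>s \<in> {1, - 1}. \<exists>v. jeffery_hamel s (s * \<Phi>) v \<and>
        (\<forall>\<sigma> \<in> {0 <..< 1}. \<forall>R > 2 * d. \<exists>c. \<forall>x \<in> half_plane s. norm x > R \<longrightarrow>
           norm x powr (1 + \<sigma>) * norm (u x - v x) \<le> c * \<bar>\<Phi>\<bar>))"

text \<open>The homogeneity of degree \<open>-1\<close> makes the leading order term unique on the half-plane. For
  a Galdi--Padula--Solonnikov solution it is therefore the Jeffery--Hamel field above.\<close>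

definition leading_order_term ::
    "real \<Rightarrow> (real^2 \<Rightarrow> real^2) \<Rightarrow> real \<Rightarrow> (real^2 \<Rightarrow> real^2) \<Rightarrow> bool" where
  "leading_order_term d u s v \<longleftrightarrow>
     (\<forall>l>0. \<forall>x \<in> half_plane s. v x = l *\<^sub>R v (l *\<^sub>R x)) \<and>
     (\<forall>\<sigma> \<in> {0 <..< 1}. \<forall>R > 2 * d. \<exists>c. \<forall>x \<in> half_plane s. norm x > R \<longrightarrow>
        norm x powr (1 + \<sigma>) * norm (u x - v x) \<le> c)"

text \<open>The sign \<open>s\<close> of the half-plane on the upstream and on the downstream side.\<close>

definition upstream :: "real \<Rightarrow> real" where
  "upstream \<Phi> = (if \<Phi> > 0 then - 1 else 1)"

definition downstream :: "real \<Rightarrow> real" where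
  "downstream \<Phi> = (if \<Phi> > 0 then 1 else - 1)"

end

(*
In angular form the leading term is v(a,b) = f(arctan(b/a)) (a,b)/(a^2+b^2), and the momentum
equation turns into f'' + 4f + f^2 = C. To first order in the flux \<Psi>, the even solution
vanishing at the walls is \<alpha>(1 + cos 2\<theta>) with \<alpha> close to \<Psi>/\<pi>; this has the sign of \<Psi> but
vanishes to second order at the walls, so the wall behaviour is decided by the quadratic term.
Testing the equation with cos 2\<theta> gives f'(\<pi>/2) = \<integral> f^2 cos 2\<theta> over (0, \<pi>/2), which is positive
for either sign of \<Psi>. Hence f is negative next to the walls in both cases, and convexity
(\<Psi> > 0) or concavity (\<Psi> < 0) of f on [\<pi>/3, \<pi>/2] yields exactly one or no sign change there.
*)
theory Submission
  imports Defs
begin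

section \<open>Small even solutions of the profile equation\<close>

text \<open>Two obstacles shape the argument. A Jeffery--Hamel profile is given only as a bounded
  continuous function, so its regularity has to be read off the velocity on the unit circle; this
  yields two derivatives inside the interval and none at the walls. The wall slope therefore becomes
  a statement about all points close to the wall, and the wall itself enters only through continuity
  and the mean value theorem. Nor can the pressure be eliminated by a curl, which would cost a third
  derivative of the profile; it is integrated instead, and this also exhibits the self-similar
  pressure. Replacing f by its linear approximation in the quadratic wall term costs an error cubic
  in \<Psi>, while the term itself has size \<Psi> squared; this comparison is the one that dictates
  how small the flux must be. The bound |f| \<le> 6|\<Psi>| supplies the smallness behind every
  estimate. The angle \<pi>/3 serves twice: before it 1 + cos 2\<theta> \<ge> 1/2, which fixes the
  sign of f, and after it cos 2\<theta> \<le> -1/2, which fixes the sign of f''.\<close>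

lemma even_profile:
  fixes f f1 :: "real \<Rightarrow> real"
  assumes cont: "continuous_on {-pi/2..pi/2} f"
    and f1: "\<And>t. t \<in> {-pi/2<..<pi/2} \<Longrightarrow> (f has_real_derivative f1 t) (at t)"
    and f2: "\<And>t. t \<in> {-pi/2<..<pi/2} \<Longrightarrow> (f1 has_real_derivative C - 4 * f t - (f t)\<^sup>2) (at t)"
    and even: "\<And>t. t \<in> {-pi/2..pi/2} \<Longrightarrow> f (-t) = f t"
    and zero: "f (pi/2) = 0"
    and bound: "\<And>t. t \<in> {-pi/2..pi/2} \<Longrightarrow> \<bar>f t\<bar> \<le> M"
  shows profile_deriv_0: "f1 0 = 0"
    and profile_dist: "\<And>t. t \<in> {-pi/2..pi/2} \<Longrightarrow> \<bar>f t - C / 4 * (1 + cos (2 * t))\<bar> \<le> 2 * M\<^sup>2"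
proof -
  have "((\<lambda>t. f (-t)) has_real_derivative f1 (-0) * -1) (at 0)"
    by (rule DERIV_chain'[of uminus]) (auto intro!: derivative_eq_intros f1)
  then have "(f has_real_derivative f1 (-0) * -1) (at 0)"
    by (rule has_field_derivative_transform_within_open[where S = "{-pi/2<..<pi/2}"]) (auto intro: even)
  moreover have "(f has_real_derivative f1 0) (at 0)"
    by (intro f1) auto
  ultimately show f10: "f1 0 = 0"
    using DERIV_unique by fastforce
  \<comment> \<open>\<open>C / 4 + \<beta> * cos (2 * t)\<close> is the even solution of the linear
    equation with the same value as \<open>f\<close> at 0; evenness excludes the sine.\<close>
  define \<beta> where "\<beta> = f 0 - C / 4"
  have est: "\<bar>f \<theta> - C / 4 - \<beta> * cos (2 * \<theta>)\<bar> \<le> M\<^sup>2" if \<theta>: "\<theta> \<in> {0<..<pi/2}" for \<theta>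
  proof -
    \<comment> \<open>Variation of constants: the kernel of \<open>f'' + 4 f\<close> cancels, so \<open>\<phi>'\<close> only contains \<open>f\<^sup>2\<close>.\<close>
    define \<phi> where "\<phi> t = f1 t * sin (2 * (\<theta> - t)) + 2 * f t * cos (2 * (\<theta> - t))
                          - C / 2 * cos (2 * (\<theta> - t))" for t
    have d: "(\<phi> has_real_derivative - (f t)\<^sup>2 * sin (2 * (\<theta> - t))) (at t within {0..\<theta>})"
      if "t \<in> {0..\<theta>}" for t
    proof -
      have "t \<in> {-pi/2<..<pi/2}" using that \<theta> by auto
      note * = f1[OF this] f2[OF this]
      show ?thesis
        unfolding \<phi>_def
        by (rule has_field_derivative_at_within)
           (rule derivative_eq_intros * refl | simp add: algebra_simps)+
    qed
    have "norm (\<phi> \<theta> - \<phi> 0) \<le> M\<^sup>2 * norm (\<theta> - 0)"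
    proof (rule field_differentiable_bound[OF _ d])
      fix t assume t: "t \<in> {0..\<theta>}"
      have "\<bar>f t\<bar> \<le> \<bar>M\<bar>" using bound[of t] t \<theta> by fastforce
      then have "(f t)\<^sup>2 \<le> M\<^sup>2" by (simp add: abs_le_square_iff)
      moreover have "\<bar>sin (2 * (\<theta> - t))\<bar> \<le> 1" by simp
      ultimately show "norm (- (f t)\<^sup>2 * sin (2 * (\<theta> - t))) \<le> M\<^sup>2"
        using mult_mono[of "(f t)\<^sup>2" "M\<^sup>2" "\<bar>sin (2 * (\<theta> - t))\<bar>" 1] by (simp add: abs_mult)
    qed (use \<theta> in auto)
    moreover have "\<phi> \<theta> - \<phi> 0 = 2 * (f \<theta> - C / 4 - \<beta> * cos (2 * \<theta>))"
      by (simp add: \<phi>_def f10 \<beta>_def algebra_simps)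
    moreover have "M\<^sup>2 * \<theta> \<le> M\<^sup>2 * 2" using \<theta> pi_less_4 by (intro mult_left_mono) auto
    ultimately show ?thesis using \<theta> by (simp add: abs_mult)
  qed
  \<comment> \<open>The wall is reached by continuity only, since \<open>f1\<close> carries no
    information there.\<close>
  have est': "\<bar>f \<theta> - C / 4 - \<beta> * cos (2 * \<theta>)\<bar> \<le> M\<^sup>2" if \<theta>: "\<theta> \<in> {0..pi/2}" for \<theta>
  proof -
    have "continuous_on {0..pi/2} (\<lambda>\<theta>. \<bar>f \<theta> - C / 4 - \<beta> * cos (2 * \<theta>)\<bar>)"
      by (intro continuous_intros continuous_on_subset[OF cont]) auto
    then have "continuous_on (closure {0<..<pi/2}) (\<lambda>\<theta>. \<bar>f \<theta> - C / 4 - \<beta> * cos (2 * \<theta>)\<bar>)"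
      by simp
    from continuous_le_on_closure[OF this _ est] show ?thesis using \<theta> by simp
  qed
  \<comment> \<open>At the wall \<open>f\<close> vanishes and the cosine is -1, so the estimate
    compares \<open>\<beta>\<close> with \<open>C / 4\<close>. Exchanging the two costs a second
    \<open>M\<^sup>2\<close>.\<close>
  have b: "\<bar>C / 4 - \<beta>\<bar> \<le> M\<^sup>2"
    using est'[of "pi/2"] zero by simp
  have pos: "\<bar>f t - C / 4 * (1 + cos (2 * t))\<bar> \<le> 2 * M\<^sup>2" if t: "t \<in> {0..pi/2}" for t
  proof -
    have "\<bar>(C / 4 - \<beta>) * cos (2 * t)\<bar> \<le> M\<^sup>2 * 1"
      unfolding abs_mult using b by (intro mult_mono) auto
    then show ?thesis using est'[OF t] by (simp add: algebra_simps abs_le_iff)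
  qed
  show "\<bar>f t - C / 4 * (1 + cos (2 * t))\<bar> \<le> 2 * M\<^sup>2" if t: "t \<in> {-pi/2..pi/2}" for t
  proof (cases "t \<ge> 0")
    case True
    then show ?thesis using pos t by auto
  next
    case False
    then have "-t \<in> {0..pi/2}" using t by auto
    from pos[OF this] show ?thesis using even[OF t] by simp
  qed
qed

text \<open>The cosine has mean zero, so the approximation carries flux \<alpha>\<pi>; a uniform
  error \<open>e\<close> on an interval of length \<pi> changes the flux by at most
  \<open>e * pi\<close>.\<close>

lemma amplitude_near_flux:
  fixes f :: "real \<Rightarrow> real"
  assumes "(f has_integral \<Psi>) {-pi/2..pi/2}"
    and "\<And>t. t \<in> {-pi/2..pi/2} \<Longrightarrow> \<bar>f t - \<alpha> * (1 + cos (2 * t))\<bar> \<le> e"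
  shows "\<bar>\<Psi> / pi - \<alpha>\<bar> \<le> e"
proof -
  have "((\<lambda>t. \<alpha> * (1 + cos (2 * t))) has_integral
      (\<alpha> * (pi/2 + sin (2 * (pi/2)) / 2) - \<alpha> * (-pi/2 + sin (2 * (-pi/2)) / 2))) {-pi/2..pi/2}"
    by (rule fundamental_theorem_of_calculus)
       (auto intro!: derivative_eq_intros simp: algebra_simps simp flip: has_real_derivative_iff_has_vector_derivative)
  then have "((\<lambda>t. f t - \<alpha> * (1 + cos (2 * t))) has_integral (\<Psi> - \<alpha> * pi)) {-pi/2..pi/2}"
    using has_integral_diff[OF assms(1)] by (simp add: algebra_simps)
  moreover have "0 \<le> e" using assms(2)[of 0] by auto
  ultimately have "norm (\<Psi> - \<alpha> * pi) \<le> e * measure lborel {-pi/2..pi/2}"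
    using assms(2) by (intro has_integral_bound_real[where S="{}"]) auto
  then have "\<bar>\<Psi> - \<alpha> * pi\<bar> \<le> e * pi" by simp
  then show ?thesis by (simp add: abs_le_iff field_simps)
qed

lemma wall_derivative_pos:
  fixes f f1 :: "real \<Rightarrow> real"
  assumes cont: "continuous_on {-pi/2..pi/2} f"
    and f1: "\<And>t. t \<in> {-pi/2<..<pi/2} \<Longrightarrow> (f has_real_derivative f1 t) (at t)"
    and f2: "\<And>t. t \<in> {-pi/2<..<pi/2} \<Longrightarrow> (f1 has_real_derivative C - 4 * f t - (f t)\<^sup>2) (at t)"
    and zero: "f (pi/2) = 0"
    and f1_0: "f1 0 = 0"
    and close: "\<And>t. t \<in> {-pi/2..pi/2} \<Longrightarrow> \<bar>(f t)\<^sup>2 - (\<alpha> * (1 + cos (2 * t)))\<^sup>2\<bar> \<le> \<delta>"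
    and \<delta>: "\<delta> < \<alpha>\<^sup>2"
  shows "\<forall>\<^sub>F t in at_left (pi/2). 0 < f1 t"
proof -
  define H where "H t = sin (2*t) + t + sin (2*t) * cos (2*t) / 2 - sin (2*t)^3 / 6" for t :: real
  \<comment> \<open>\<open>W\<close> is minus the integral of \<open>f\<^sup>2 cos 2t\<close> from \<open>0\<close>, which \<open>- \<alpha>\<^sup>2 H\<close> approximates,
    and \<open>W\<close> tends to \<open>- f1\<close> at \<open>\<pi>/2\<close>.\<close>
  define W where "W t = f1 t * cos (2 * t) + 2 * f t * sin (2 * t) - C / 2 * sin (2 * t)" for t
  have H': "(H has_real_derivative (1 + cos (2 * t))\<^sup>2 * cos (2 * t)) (at t)" for t
  proof -
    have s: "sin (2*t) * sin (2*t) = 1 - cos (2*t) * cos (2*t)"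
      using sin_cos_squared_add[of "2*t"] by (simp add: power2_eq_square)
    have eq: "2 * cos (2*t) + 1 + (cos (2*t) * cos (2*t) - sin (2*t) * sin (2*t))
        - (sin (2*t) * sin (2*t)) * cos (2*t) = (1 + cos (2 * t))\<^sup>2 * cos (2 * t)"
      unfolding s by (simp add: power2_eq_square algebra_simps)
    have "(H has_real_derivative 2 * cos (2*t) + 1 + (cos (2*t) * cos (2*t) - sin (2*t) * sin (2*t))
        - (sin (2*t) * sin (2*t)) * cos (2*t)) (at t)"
      unfolding H_def
      by (rule derivative_eq_intros refl | simp add: power2_eq_square field_simps)+
    then show ?thesis unfolding eq .
  qed
  have W_le: "W \<theta> \<le> \<delta> * \<theta> - \<alpha>\<^sup>2 * H \<theta>" if \<theta>: "\<theta> \<in> {0<..<pi/2}" for \<theta>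
  proof -
    have "W \<theta> + \<alpha>\<^sup>2 * H \<theta> - \<delta> * \<theta> \<le> W 0 + \<alpha>\<^sup>2 * H 0 - \<delta> * 0"
    proof (rule DERIV_nonpos_imp_nonincreasing[where f = "\<lambda>t. W t + \<alpha>\<^sup>2 * H t - \<delta> * t"])
      fix t assume t: "0 \<le> t" "t \<le> \<theta>"
      then have t': "t \<in> {-pi/2<..<pi/2}" using \<theta> by auto
      have "(W has_real_derivative - (f t)\<^sup>2 * cos (2 * t)) (at t)"
        unfolding W_def
        by (rule derivative_eq_intros f1[OF t'] f2[OF t'] refl | simp add: algebra_simps)+
      then have "((\<lambda>t. W t + \<alpha>\<^sup>2 * H t - \<delta> * t) has_real_derivative
          - (f t)\<^sup>2 * cos (2 * t) + \<alpha>\<^sup>2 * ((1 + cos (2 * t))\<^sup>2 * cos (2 * t)) - \<delta>) (at t)"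
        by (auto intro!: derivative_eq_intros H')
      moreover have "\<bar>((f t)\<^sup>2 - (\<alpha> * (1 + cos (2 * t)))\<^sup>2) * cos (2 * t)\<bar> \<le> \<delta> * 1"
        unfolding abs_mult by (rule mult_mono) (use close[of t] t' in auto)
      then have "- (f t)\<^sup>2 * cos (2 * t) + \<alpha>\<^sup>2 * ((1 + cos (2 * t))\<^sup>2 * cos (2 * t)) - \<delta> \<le> 0"
        unfolding abs_le_iff power_mult_distrib by (simp add: algebra_simps)
      ultimately show "\<exists>y. ((\<lambda>t. W t + \<alpha>\<^sup>2 * H t - \<delta> * t) has_real_derivative y) (at t) \<and> y \<le> 0"
        by blast
    qed (use \<theta> in auto)
    then show ?thesis by (simp add: W_def H_def f1_0)
  qed
  \<comment> \<open>\<open>U\<close> is the bound of \<open>W_le\<close> with the terms of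
    \<open>W\<close> free of \<open>f1\<close> moved across, hence an upper bound for
    \<open>f1 t * cos (2 * t)\<close> that is continuous up to the wall. There \<open>H\<close>
    equals \<pi>/2, so \<open>U (pi/2)\<close> is (\<delta> -
    \<open>\<alpha>\<^sup>2\<close>)\<pi>/2.\<close>
  define U where "U t = \<delta> * t - \<alpha>\<^sup>2 * H t - 2 * f t * sin (2 * t) + C / 2 * sin (2 * t)" for t
  have "continuous_on {-pi/2..pi/2} U"
    unfolding U_def H_def by (intro continuous_intros cont) auto
  then have "(U \<longlongrightarrow> U (pi/2)) (at_left (pi/2))"
    by (auto simp: continuous_on_Icc_at_leftD)
  moreover have "U (pi/2) < 0"
    using \<delta> by (simp add: U_def H_def zero)
  ultimately have "\<forall>\<^sub>F t in at_left (pi/2). U t < 0"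
    by (rule order_tendstoD(2))
  \<comment> \<open>Beyond \<pi>/4 the factor \<open>cos (2 * t)\<close> is negative, which turns
    the negative product into a positive \<open>f1 t\<close>.\<close>
  moreover have "\<forall>\<^sub>F t in at_left (pi/2). t \<in> {pi/4<..<pi/2}"
    by (rule eventually_at_left_real) simp
  ultimately show ?thesis
  proof eventually_elim
    case (elim t)
    have "f1 t * cos (2 * t) < 0"
      using elim W_le[of t] by (simp add: W_def U_def)
    moreover have "cos (2 * t) < 0"
      using elim cos_gt_zero[of "pi - 2*t"] by (simp add: cos_diff)
    ultimately show ?case by (simp add: mult_less_0_iff)
  qed
qed

lemma half_le_one_plus_cos:
  assumes "t \<in> {0..pi/3}"
  shows "1/2 \<le> 1 + cos (2 * t)"
proof -
  have "cos (2 * pi / 3) \<le> cos (2 * t)" using assms by (intro cos_monotone_0_pi_le) auto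
  then show ?thesis by (simp add: cos_120)
qed

section \<open>Profiles of small nonzero flux: amplitude, wall slope and sign pattern\<close>

locale small_profile =
  fixes f f1 :: "real \<Rightarrow> real" and C \<Psi> :: real
  assumes cont: "continuous_on {-pi/2..pi/2} f"
    and f1: "\<And>t. t \<in> {-pi/2<..<pi/2} \<Longrightarrow> (f has_real_derivative f1 t) (at t)"
    and f2: "\<And>t. t \<in> {-pi/2<..<pi/2} \<Longrightarrow> (f1 has_real_derivative C - 4 * f t - (f t)\<^sup>2) (at t)"
    and even: "\<And>t. t \<in> {-pi/2..pi/2} \<Longrightarrow> f (-t) = f t"
    and zero: "f (pi/2) = 0"
    and bound: "\<And>t. t \<in> {-pi/2..pi/2} \<Longrightarrow> \<bar>f t\<bar> \<le> 6 * \<bar>\<Psi>\<bar>"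
    and flux: "(f has_integral \<Psi>) {-pi/2..pi/2}"
    and small: "\<bar>\<Psi>\<bar> \<le> 1/100000" and nonzero: "\<Psi> \<noteq> 0"
begin

definition \<alpha> where "\<alpha> = C / 4"

text \<open>The constant is 2 times 6 squared: the error \<open>2 * M\<^sup>2\<close> for the bound
  M = 6|\<Psi>|.\<close>

lemma close_to_cosine: "t \<in> {-pi/2..pi/2} \<Longrightarrow> \<bar>f t - \<alpha> * (1 + cos (2 * t))\<bar> \<le> 72 * \<Psi>\<^sup>2"
  using profile_dist[OF cont f1 f2 even zero bound] unfolding \<alpha>_def
  by (simp add: power_mult_distrib)

text \<open>Turns quadratic errors into tiny multiples of |\<Psi>|, so that the sign arguments below
  become linear comparisons.\<close>

lemma sq_small: "\<Psi>\<^sup>2 \<le> \<bar>\<Psi>\<bar> / 100000"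
  using small mult_left_mono[of "\<bar>\<Psi>\<bar>" "1/100000" "\<bar>\<Psi>\<bar>"] by (simp add: power2_eq_square)

text \<open>Since 3 < \<pi> < 4, the value \<Psi>/\<pi> lies between \<Psi>/4 and \<Psi>/3; widening
  this to \<Psi>/5 and \<Psi> absorbs the quadratic error.\<close>

lemma amplitude_pos: "\<Psi> > 0 \<Longrightarrow> \<Psi> / 5 \<le> \<alpha> \<and> \<alpha> \<le> \<Psi>"
  and amplitude_neg: "\<Psi> < 0 \<Longrightarrow> \<Psi> \<le> \<alpha> \<and> \<alpha> \<le> \<Psi> / 5"
proof -
  have d: "\<bar>\<Psi> / pi - \<alpha>\<bar> \<le> 72 * \<Psi>\<^sup>2"
    using amplitude_near_flux[OF flux close_to_cosine] by blast
  have p: "\<bar>\<Psi>\<bar> / 4 \<le> \<bar>\<Psi>\<bar> / pi" "\<bar>\<Psi>\<bar> / pi \<le> \<bar>\<Psi>\<bar> / 3"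
    using pi_less_4 pi_gt3 by (intro divide_left_mono; simp)+
  show "\<Psi> > 0 \<Longrightarrow> \<Psi> / 5 \<le> \<alpha> \<and> \<alpha> \<le> \<Psi>" using d p sq_small by (auto simp: abs_le_iff)
  show "\<Psi> < 0 \<Longrightarrow> \<Psi> \<le> \<alpha> \<and> \<alpha> \<le> \<Psi> / 5" using d p sq_small by (auto simp: abs_le_iff)
qed

lemma f1_pos_near_wall: "\<forall>\<^sub>F t in at_left (pi/2). 0 < f1 t"
proof (rule wall_derivative_pos[OF cont f1 f2 zero profile_deriv_0[OF cont f1 f2 even zero bound]])
  have a: "\<bar>\<alpha>\<bar> \<le> \<bar>\<Psi>\<bar>" "\<bar>\<Psi>\<bar> / 5 \<le> \<bar>\<alpha>\<bar>"
    using amplitude_pos amplitude_neg nonzero by linarith+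
  \<comment> \<open>Factor the difference of squares: one factor is the distance to the cosine
    profile, the other is at most 6|\<Psi>| + 2|\<Psi>|.\<close>
  show "\<bar>(f t)\<^sup>2 - (\<alpha> * (1 + cos (2 * t)))\<^sup>2\<bar> \<le> 72 * \<Psi>\<^sup>2 * (8 * \<bar>\<Psi>\<bar>)"
    if t: "t \<in> {-pi/2..pi/2}" for t
  proof -
    have "\<bar>\<alpha> * (1 + cos (2 * t))\<bar> \<le> \<bar>\<Psi>\<bar> * 2"
      unfolding abs_mult
      using a cos_le_one[of "2 * t"] cos_ge_minus_one[of "2 * t"]
      by (intro mult_mono) (auto simp: abs_le_iff simp del: cos_le_one cos_ge_minus_one)
    then have "\<bar>f t + \<alpha> * (1 + cos (2 * t))\<bar> \<le> 8 * \<bar>\<Psi>\<bar>"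
      using bound[OF t] by linarith
    then have "\<bar>f t - \<alpha> * (1 + cos (2 * t))\<bar> * \<bar>f t + \<alpha> * (1 + cos (2 * t))\<bar> \<le> 72 * \<Psi>\<^sup>2 * (8 * \<bar>\<Psi>\<bar>)"
      using close_to_cosine[OF t] by (intro mult_mono) auto
    moreover have "(f t)\<^sup>2 - g\<^sup>2 = (f t - g) * (f t + g)" for g
      by (simp add: power2_eq_square algebra_simps)
    ultimately show ?thesis by (simp add: abs_mult)
  qed
  \<comment> \<open>The cubic error has coefficient 72 * 8 = 576, so any |\<Psi>| below 1/14400
    would do here. This is the most demanding use of the threshold 1/100000.\<close>
  have "\<Psi>\<^sup>2 / 25 \<le> \<alpha>\<^sup>2"
    using power_mono[OF a(2), of 2] by (simp add: power_divide)
  moreover have "72 * \<Psi>\<^sup>2 * (8 * \<bar>\<Psi>\<bar>) < \<Psi>\<^sup>2 / 25"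
    using nonzero small by (simp add: field_simps)
  ultimately show "72 * \<Psi>\<^sup>2 * (8 * \<bar>\<Psi>\<bar>) < \<alpha>\<^sup>2" by linarith
qed

text \<open>For the cosine profile the expression is -4\<alpha> cos 2t, which beyond \<pi>/3 has the
  sign of \<alpha> and size at least 2|\<alpha>|. The deviation of \<open>f\<close> and the square
  of \<open>f\<close> together contribute only a multiple of \<Psi> squared.\<close>

lemma
  assumes t: "t \<in> {pi/3..<pi/2}"
  shows f2_pos: "\<Psi> > 0 \<Longrightarrow> 0 < C - 4 * f t - (f t)\<^sup>2"
    and f2_neg: "\<Psi> < 0 \<Longrightarrow> C - 4 * f t - (f t)\<^sup>2 < 0"
proof -
  have t': "t \<in> {-pi/2..pi/2}" using t by auto
  define g where "g = \<alpha> * (1 + cos (2 * t))"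
  have "cos (2 * t) \<le> cos (2 * pi / 3)" using t by (intro cos_monotone_0_pi_le) auto
  then have c: "cos (2 * t) \<le> - 1/2" by (simp add: cos_120)
  have "(f t)\<^sup>2 \<le> (6 * \<bar>\<Psi>\<bar>)\<^sup>2" using bound[OF t'] abs_le_square_iff by fastforce
  then have sq: "(f t)\<^sup>2 \<le> 36 * \<Psi>\<^sup>2" by (simp add: power_mult_distrib)
  have d: "\<bar>f t - g\<bar> \<le> 72 * \<Psi>\<^sup>2" using close_to_cosine[OF t'] by (simp add: g_def)
  have g: "C - 4 * g = - 4 * (\<alpha> * cos (2 * t))" by (simp add: g_def \<alpha>_def algebra_simps)
  show "0 < C - 4 * f t - (f t)\<^sup>2" if "\<Psi> > 0"
  proof -
    have a: "\<Psi> / 5 \<le> \<alpha>" using amplitude_pos that by blast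
    then have "\<alpha> * cos (2 * t) \<le> \<alpha> * (-1/2)" using c that by (intro mult_left_mono) auto
    then show ?thesis using d sq sq_small a g that by (simp add: abs_le_iff)
  qed
  show "C - 4 * f t - (f t)\<^sup>2 < 0" if "\<Psi> < 0"
  proof -
    have a: "\<alpha> \<le> \<Psi> / 5" using amplitude_neg that by blast
    then have "\<alpha> * (-1/2) \<le> \<alpha> * cos (2 * t)" using c that by (intro mult_left_mono_neg) auto
    then show ?thesis using d sq sq_small a g that zero_le_power2[of "f t"] unfolding abs_le_iff by linarith
  qed
qed

text \<open>Up to \<pi>/3 the cosine profile has size at least |\<alpha>|/2, hence |\<Psi>|/10,
  which exceeds the error 72 \<open>\<Psi>\<^sup>2\<close>.\<close>

lemma
  assumes t: "t \<in> {0..pi/3}"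
  shows core_pos: "\<Psi> > 0 \<Longrightarrow> 0 < f t" and core_neg: "\<Psi> < 0 \<Longrightarrow> f t < 0"
proof -
  have t': "t \<in> {-pi/2..pi/2}" using t by auto
  note c = half_le_one_plus_cos[OF t] and d = close_to_cosine[OF t']
  show "0 < f t" if "\<Psi> > 0"
  proof -
    have a: "\<Psi> / 5 \<le> \<alpha>" using amplitude_pos that by blast
    then have "\<alpha> * (1/2) \<le> \<alpha> * (1 + cos (2 * t))" using c that by (intro mult_left_mono) auto
    then show ?thesis using d sq_small a that unfolding abs_le_iff by linarith
  qed
  show "f t < 0" if "\<Psi> < 0"
  proof -
    have a: "\<alpha> \<le> \<Psi> / 5" using amplitude_neg that by blast
    then have "\<alpha> * (1 + cos (2 * t)) \<le> \<alpha> * (1/2)" using c that by (intro mult_left_mono_neg) auto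
    then show ?thesis using d sq_small a that unfolding abs_le_iff by linarith
  qed
qed

text \<open>The case \<open>y = pi/2\<close> matters: it needs only continuity at the wall and links
  interior slopes to the value 0 there.\<close>

lemma mean_value:
  assumes "0 \<le> x" "x < y" "y \<le> pi/2"
  shows "\<exists>z. x < z \<and> z < y \<and> f y - f x = (y - x) * f1 z"
proof -
  have "continuous_on {x..y} f" using cont assms pi_gt_zero
    by (elim continuous_on_subset) auto
  moreover have "f differentiable (at z)" if "x < z" "z < y" for z
    using f1[of z] that assms by (auto simp: real_differentiable_def)
  ultimately obtain l z where z: "x < z" "z < y" "(f has_real_derivative l) (at z)"
      "f y - f x = (y - x) * l"
    using MVT[of x y f] \<open>x < y\<close> by blast
  moreover have "l = f1 z" using f1[of z] z assms DERIV_unique by fastforce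
  ultimately show ?thesis by blast
qed

lemma negative_flux_sign:
  assumes "\<Psi> < 0" and t: "t \<in> {-pi/2<..<pi/2}"
  shows "f t < 0"
proof -
  have dec: "f1 y < f1 x" if "x \<in> {pi/3..<pi/2}" "y \<in> {pi/3..<pi/2}" "x < y" for x y
    using that(3)
  proof (rule DERIV_neg_imp_decreasing)
    fix u assume "x \<le> u" "u \<le> y"
    then show "\<exists>D. (f1 has_real_derivative D) (at u) \<and> D < 0"
      using that f2[of u] f2_neg[OF _ assms(1), of u] by auto
  qed
  \<comment> \<open>A strictly decreasing slope that is still positive at points arbitrarily close
    to the wall is positive at every earlier point of the concave range.\<close>
  have pos: "0 < f1 x" if "x \<in> {pi/3..<pi/2}" for x
  proof -
    have "\<forall>\<^sub>F t in at_left (pi/2). t \<in> {x<..<pi/2}"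
      using that by (intro eventually_at_left_real) auto
    then obtain y where "y \<in> {x<..<pi/2}" "0 < f1 y"
      using eventually_happens'[OF _ eventually_conj[OF f1_pos_near_wall]] by fastforce
    then show ?thesis using dec[of x y] that by auto
  qed
  have half: "f t < 0" if t: "t \<in> {0..<pi/2}" for t
  proof (cases "t \<le> pi/3")
    case True
    then show ?thesis using core_neg assms t by auto
  next
    case False
    then obtain z where "t < z" "z < pi/2" "f (pi/2) - f t = (pi/2 - t) * f1 z"
      using mean_value[of t "pi/2"] t by auto
    moreover have "0 < (pi/2 - t) * f1 z"
      using pos[of z] calculation False t by (intro mult_pos_pos) auto
    ultimately show ?thesis using zero by simp
  qed
  show ?thesis
    using half[of "\<bar>t\<bar>"] t even[of t] by (cases "0 \<le> t") auto
qed

lemma positive_flux_sign: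
  assumes "0 < \<Psi>"
  obtains a where "0 < a" "a < pi/2" "\<And>t. \<bar>t\<bar> < a \<Longrightarrow> 0 < f t" "f a = 0" "f (-a) = 0"
    "\<And>t. a < \<bar>t\<bar> \<Longrightarrow> \<bar>t\<bar> < pi/2 \<Longrightarrow> f t < 0"
proof -
  have inc: "f1 x < f1 y" if "x \<in> {pi/3..<pi/2}" "y \<in> {pi/3..<pi/2}" "x < y" for x y
    using that(3)
  proof (rule DERIV_pos_imp_increasing)
    fix u assume "x \<le> u" "u \<le> y"
    then show "\<exists>D. (f1 has_real_derivative D) (at u) \<and> 0 < D"
      using that f2[of u] f2_pos[OF _ assms, of u] by auto
  qed
  \<comment> \<open>If \<open>f\<close> does not drop from \<open>x\<close> to \<open>y\<close>, the
    slope is nonnegative somewhere between them, hence by convexity positive after \<open>y\<close>;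
    so \<open>f\<close> climbs strictly from \<open>f y\<close> to the wall value 0. This one fact
    gives both sign claims around the zero \<open>a\<close>: with \<open>y = a\<close> it excludes
    values \<le> 0 before \<open>a\<close>, with \<open>x = a\<close> values \<ge> 0 after
    it.\<close>
  have no_rise: "f y < 0" if "pi/3 \<le> x" "x < y" "y < pi/2" "f x \<le> f y" for x y
  proof -
    have "0 \<le> x" using that(1) pi_gt_zero by linarith
    then obtain z where z: "x < z" "z < y" "f y - f x = (y - x) * f1 z"
      using mean_value[of x y] \<open>x < y\<close> \<open>y < pi/2\<close> by fastforce
    then have "0 \<le> f1 z" using that by (metis diff_ge_0_iff_ge diff_gt_0_iff_gt zero_le_mult_iff not_less)
    moreover obtain w where w: "y < w" "w < pi/2" "f (pi/2) - f y = (pi/2 - y) * f1 w"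
      using mean_value[of y "pi/2"] \<open>x < y\<close> \<open>y < pi/2\<close> \<open>0 \<le> x\<close> by auto
    ultimately have "0 < f1 w" using inc[of z w] z that by auto
    then have "0 < (pi/2 - y) * f1 w" using that by simp
    then show ?thesis using w zero by simp
  qed
  obtain b where b: "b < pi/2" "\<And>y. b < y \<Longrightarrow> y < pi/2 \<Longrightarrow> 0 < f1 y"
    using f1_pos_near_wall eventually_at_left[of "pi/3" "pi/2"] by auto
  \<comment> \<open>\<open>b\<close> may lie to the left of \<pi>/3. The midpoint
    \<open>\<eta>\<close> between \<open>m\<close> and the wall lies in the convex range and the
    slope is positive from there on, so \<open>f \<eta>\<close> is negative and the intermediate
    value theorem has its second sign.\<close>
  define m where "m = max b (pi/3)"
  have m: "b \<le> m" "pi/3 \<le> m" "m < pi/2" using b(1) pi_gt_zero by (simp_all add: m_def del: pi_gt_zero)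
  define \<eta> where "\<eta> = (m + pi/2) / 2"
  have \<eta>: "b < \<eta>" "pi/3 < \<eta>" "\<eta> < pi/2" using m by (auto simp: \<eta>_def)
  obtain w where w: "\<eta> < w" "w < pi/2" "f (pi/2) - f \<eta> = (pi/2 - \<eta>) * f1 w"
    using mean_value[of \<eta> "pi/2"] \<eta> by auto
  have "0 < (pi/2 - \<eta>) * f1 w" using w \<eta> b(2)[of w] by simp
  then have f\<eta>: "f \<eta> < 0" using w zero by simp
  have f3: "0 < f (pi/3)" using core_pos[OF _ assms] by simp
  have "continuous_on {pi/3..\<eta>} f" using cont \<eta> by (auto elim: continuous_on_subset)
  then obtain a where a: "pi/3 \<le> a" "a \<le> \<eta>" "f a = 0"
    using IVT2'[of f \<eta> 0 "pi/3"] f\<eta> f3 \<eta> by auto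
  have pos: "0 < f t" if "0 \<le> t" "t < a" for t
  proof (cases "t \<le> pi/3")
    case True
    then show ?thesis using core_pos[OF _ assms] that by auto
  next
    case False
    then show ?thesis using no_rise[of t a] that a \<eta> by force
  qed
  have neg: "f t < 0" if "a < t" "t < pi/2" for t
    using no_rise[of a t] that a by force
  show ?thesis
  proof (rule that[of a])
    show "0 < a" "a < pi/2" using a \<eta> pi_gt_zero by linarith+
    show "f a = 0" "f (-a) = 0" using a even[of a] \<eta> pi_gt_zero by auto
    show "0 < f t" if "\<bar>t\<bar> < a" for t
      using pos[of "\<bar>t\<bar>"] that even[of t] a \<eta> by (cases "0 \<le> t") auto
    show "f t < 0" if "a < \<bar>t\<bar>" "\<bar>t\<bar> < pi/2" for t
      using neg[of "\<bar>t\<bar>"] that even[of t] by (cases "0 \<le> t") auto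
  qed
qed

section \<open>Intervals of constant sign\<close>

lemma negative_flux_components:
  assumes "\<Psi> < 0"
  shows "components {t \<in> {-pi/2<..<pi/2}. f t > 0} = {}"
    and "components {t \<in> {-pi/2<..<pi/2}. f t < 0} = {{-pi/2<..<pi/2}}"
proof -
  have "{t \<in> {-pi/2<..<pi/2}. f t > 0} = {}"
    using negative_flux_sign[OF assms] by fastforce
  then show "components {t \<in> {-pi/2<..<pi/2}. f t > 0} = {}" by simp
  have "{t \<in> {-pi/2<..<pi/2}. f t < 0} = {-pi/2<..<pi/2}"
    using negative_flux_sign[OF assms] by blast
  then show "components {t \<in> {-pi/2<..<pi/2}. f t < 0} = {{-pi/2<..<pi/2}}"
    by (simp add: components_eq_sing_iff not_le)
qed

lemma positive_flux_components:
  assumes "0 < \<Psi>"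
  obtains a where "0 < a" "a < pi/2"
    "components {t \<in> {-pi/2<..<pi/2}. f t > 0} = {{-a<..<a}}"
    "components {t \<in> {-pi/2<..<pi/2}. f t < 0} = {{-pi/2<..<-a}, {a<..<pi/2}}"
proof -
  obtain a where a: "0 < a" "a < pi/2" "\<And>t. \<bar>t\<bar> < a \<Longrightarrow> 0 < f t" "f a = 0" "f (-a) = 0"
    "\<And>t. a < \<bar>t\<bar> \<Longrightarrow> \<bar>t\<bar> < pi/2 \<Longrightarrow> f t < 0"
    using positive_flux_sign[OF assms] by blast
  have trichotomy: "\<bar>t\<bar> < a \<and> 0 < f t \<or> \<bar>t\<bar> = a \<and> f t = 0 \<or> a < \<bar>t\<bar> \<and> f t < 0"
    if "\<bar>t\<bar> < pi/2" for t
  proof (cases "\<bar>t\<bar>" a rule: linorder_cases)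
    case equal
    then have "t = a \<or> t = -a" by linarith
    then show ?thesis using a(4,5) equal by auto
  qed (use a that in auto)
  have "{t \<in> {-pi/2<..<pi/2}. f t > 0} = {-a<..<a}"
  proof (intro set_eqI iffI)
    fix t assume "t \<in> {t \<in> {-pi/2<..<pi/2}. f t > 0}"
    then show "t \<in> {-a<..<a}" using trichotomy[of t] by fastforce
  qed (use a in auto)
  then have 1: "components {t \<in> {-pi/2<..<pi/2}. f t > 0} = {{-a<..<a}}"
    using a(1) by (simp add: components_eq_sing_iff)
  have "components {t \<in> {-pi/2<..<pi/2}. f t < 0} = {{-pi/2<..<-a}, {a<..<pi/2}}"
  proof (rule components_open_unique)
    show "pairwise disjnt {{-pi/2<..<-a}, {a<..<pi/2}}"
      using a by (auto simp: pairwise_def disjnt_def)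
    show "\<Union> {{-pi/2<..<-a}, {a<..<pi/2}} = {t \<in> {-pi/2<..<pi/2}. f t < 0}"
    proof (intro set_eqI iffI)
      fix t assume "t \<in> {t \<in> {-pi/2<..<pi/2}. f t < 0}"
      then show "t \<in> \<Union> {{-pi/2<..<-a}, {a<..<pi/2}}" using trichotomy[of t] by fastforce
    qed (use a in auto)
  qed (use a in auto)
  with 1 a show ?thesis using that by blast
qed

end

section \<open>Polar coordinates in the half-planes\<close>

lemma vector_2_eta: "(x::real^2) = vector [x $ 1, x $ 2]"
  by (simp add: vec_eq_iff forall_2)

lemma has_real_derivative_along_curve:
  fixes g :: "real^2 \<Rightarrow> real"
  assumes g: "g differentiable (at (vector [\<alpha> t, \<beta> t]))"
    and \<alpha>: "(\<alpha> has_real_derivative a) (at t)" and \<beta>: "(\<beta> has_real_derivative b) (at t)"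
  shows "((\<lambda>t. g (vector [\<alpha> t, \<beta> t])) has_real_derivative
           a * pd 1 g (vector [\<alpha> t, \<beta> t]) + b * pd 2 g (vector [\<alpha> t, \<beta> t])) (at t)"
proof -
  let ?x = "vector [\<alpha> t, \<beta> t] :: real^2"
  have eq: "(vector [c, e] :: real^2) = c *\<^sub>R axis 1 1 + e *\<^sub>R axis 2 1" for c e
    by (simp add: vec_eq_iff forall_2 axis_def)
  have "((\<lambda>t. vector [\<alpha> t, \<beta> t] :: real^2) has_derivative
      (\<lambda>h. (h * a) *\<^sub>R axis 1 1 + (h * b) *\<^sub>R axis 2 1)) (at t)"
    unfolding eq using \<alpha> \<beta>
    by (auto intro!: derivative_eq_intros simp: has_field_derivative_def mult_ac)
  moreover have g': "(g has_derivative frechet_derivative g (at ?x)) (at ?x)"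
    using g frechet_derivative_works by blast
  ultimately have *: "((\<lambda>t. g (vector [\<alpha> t, \<beta> t])) has_derivative
      (\<lambda>h. frechet_derivative g (at ?x) ((h * a) *\<^sub>R axis 1 1 + (h * b) *\<^sub>R axis 2 1))) (at t)"
    by (rule has_derivative_compose)
  have l: "linear (frechet_derivative g (at ?x))"
    using g' has_derivative_linear by blast
  show ?thesis
    unfolding has_field_derivative_def
    by (rule has_derivative_eq_rhs[OF *])
       (simp add: fun_eq_iff linear_add[OF l] linear_scale[OF l] pd_def algebra_simps)
qed

text \<open>A horizontal line leaves the half-plane, so the formula for \<open>g\<close> is required
  only where \<open>0 < s * t\<close>; vertical lines stay inside, so the analogue for the second
  coordinate needs no such restriction.\<close>

lemma pd_1_eqI:
  fixes g :: "real^2 \<Rightarrow> real"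
  assumes "0 < s * a" and "g differentiable (at (vector [a, b]))"
    and "\<And>t. 0 < s * t \<Longrightarrow> g (vector [t, b]) = G t"
    and "(G has_real_derivative D) (at a)"
  shows "pd 1 g (vector [a, b]) = D"
proof -
  have "((\<lambda>t. g (vector [t, b])) has_real_derivative pd 1 g (vector [a, b])) (at a)"
    using has_real_derivative_along_curve[of g "\<lambda>t. t" a "\<lambda>_. b" 1 0] assms(2) by auto
  moreover have "open {t. 0 < s * t}"
    by (intro open_Collect_less continuous_intros)
  ultimately have "(G has_real_derivative pd 1 g (vector [a, b])) (at a)"
    using assms(1,3) by (elim has_field_derivative_transform_within_open) auto
  then show ?thesis
    using assms(4) DERIV_unique by blast
qed

lemma pd_2_eqI:
  fixes g :: "real^2 \<Rightarrow> real"
  assumes "g differentiable (at (vector [a, b]))"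
    and "\<And>t. g (vector [a, t]) = G t"
    and "(G has_real_derivative D) (at b)"
  shows "pd 2 g (vector [a, b]) = D"
proof -
  have "((\<lambda>t. g (vector [a, t])) has_real_derivative pd 2 g (vector [a, b])) (at b)"
    using has_real_derivative_along_curve[of g "\<lambda>_. a" b "\<lambda>t. t" 0 1] assms(1) by auto
  then show ?thesis
    using assms(2,3) DERIV_unique by (metis (no_types, lifting) ext)
qed

lemma polar_eq: "polar s r \<theta> = vector [s * r * cos \<theta>, s * r * sin \<theta>]"
  by (simp add: polar_def vec_eq_iff forall_2)

text \<open>The sign \<open>s\<close> multiplies both coordinates and cancels in
  \<open>b / a\<close>, so one angle formula serves both half-planes.\<close>

lemma polar_arctan:
  assumes "s = 1 \<or> s = -1" "0 < s * a"
  shows "polar s (sqrt (a\<^sup>2 + b\<^sup>2)) (arctan (b / a)) = vector [a, b]"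
proof -
  have a: "a \<noteq> 0" "\<bar>a\<bar> = s * a" using assms by auto
  have "sqrt (1 + (b / a)\<^sup>2) = sqrt (a\<^sup>2 + b\<^sup>2) / \<bar>a\<bar>"
    using a(1) by (simp add: power_divide add_divide_eq_iff[symmetric] real_sqrt_divide[symmetric]
        flip: real_sqrt_abs) (simp add: field_simps)
  moreover have "sqrt (a\<^sup>2 + b\<^sup>2) \<noteq> 0" using a(1) by (simp add: sum_power2_eq_zero_iff)
  ultimately show ?thesis
    using a assms(1)
    by (auto simp: polar_eq cos_arctan sin_arctan vec_eq_iff forall_2)
qed

lemma polar_inverse:
  assumes "s = 1 \<or> s = -1" "0 < s * x $ 1"
  obtains r \<theta> where "0 < r" "\<theta> \<in> {-pi/2<..<pi/2}" "x = polar s r \<theta>"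
proof
  show "0 < sqrt ((x$1)\<^sup>2 + (x$2)\<^sup>2)"
    using assms by (auto simp: sum_power2_gt_zero_iff)
  show "arctan (x$2 / x$1) \<in> {-pi/2<..<pi/2}"
    using arctan_bounded by auto
  show "x = polar s (sqrt ((x$1)\<^sup>2 + (x$2)\<^sup>2)) (arctan (x$2 / x$1))"
    using polar_arctan[OF assms, of "x$2"] vector_2_eta[of x] by simp
qed

lemma polar_in_half_plane:
  assumes "s = 1 \<or> s = -1" "0 < r" "\<theta> \<in> {-pi/2<..<pi/2}"
  shows "polar s r \<theta> \<in> half_plane s"
proof -
  have "cos \<theta> > 0" using assms(3) by (intro cos_gt_zero_pi) auto
  then show ?thesis using assms by (auto simp: polar_eq half_plane_def)
qed

lemma radial_field_cartesian:
  assumes "s = 1 \<or> s = -1" "0 < s * a" and v: "radial_field s f v"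
  shows "v (vector [a, b]) = (f (arctan (b / a)) / (a\<^sup>2 + b\<^sup>2)) *\<^sub>R vector [a, b]"
proof -
  define r where "r = sqrt (a\<^sup>2 + b\<^sup>2)"
  define \<theta> where "\<theta> = arctan (b / a)"
  have r: "0 < r" and r2: "a\<^sup>2 + b\<^sup>2 = r * r"
    using assms by (auto simp: r_def sum_power2_gt_zero_iff)
  have ab: "vector [a, b] = polar s r \<theta>"
    unfolding r_def \<theta>_def using polar_arctan[OF assms(1,2)] by simp
  have "\<theta> \<in> {-pi/2..pi/2}" using arctan_bounded[of "b/a"] by (auto simp: \<theta>_def)
  with v r have "v (polar s r \<theta>) = (f \<theta> / r) *\<^sub>R polar s 1 \<theta>"
    unfolding radial_field_def by blast
  also have "\<dots> = (f \<theta> / (r * r)) *\<^sub>R polar s r \<theta>"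
    using r by (simp add: polar_def)
  finally show ?thesis unfolding r2 ab \<theta>_def[symmetric] .
qed

lemma radial_field_homogeneous:
  assumes "s = 1 \<or> s = -1" "radial_field s f v" "0 < l" "x \<in> half_plane s"
  shows "v x = l *\<^sub>R v (l *\<^sub>R x)"
proof -
  obtain r \<theta> where r: "0 < r" "\<theta> \<in> {-pi/2<..<pi/2}" "x = polar s r \<theta>"
    using polar_inverse assms(1,4) unfolding half_plane_def by blast
  have "l *\<^sub>R x = polar s (l * r) \<theta>" by (simp add: r(3) polar_def mult_ac)
  then show ?thesis
    using assms(2,3) r unfolding radial_field_def by auto
qed

section \<open>Radial solutions of the Navier--Stokes equations\<close>

lemma Ck_on_2D:
  assumes "Ck_on 2 g S" "x \<in> S"
  shows "g differentiable (at x)" "pd i g differentiable (at x)"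
  using assms by (simp_all add: numeral_2_eq_2)

lemma Ck_on_1D: "Ck_on 1 g S \<Longrightarrow> x \<in> S \<Longrightarrow> g differentiable (at x)"
  by simp

locale radial_flow =
  fixes s :: real and f :: "real \<Rightarrow> real" and v :: "real^2 \<Rightarrow> real^2" and p :: "real^2 \<Rightarrow> real"
  assumes s: "s = 1 \<or> s = -1"
    and rad: "radial_field s f v"
    and ns: "navier_stokes (half_plane s) v p"
begin

lemma v_diff: "x \<in> half_plane s \<Longrightarrow> (\<lambda>y. v y $ i) differentiable (at x)"
  and pd_v_diff: "x \<in> half_plane s \<Longrightarrow> pd j (\<lambda>y. v y $ i) differentiable (at x)"
  and p_diff: "x \<in> half_plane s \<Longrightarrow> p differentiable (at x)"
  using ns Ck_on_2D Ck_on_1D unfolding navier_stokes_def by blast+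

lemma vector_in_half_plane: "vector [a, b] \<in> half_plane s \<longleftrightarrow> 0 < s * a"
  by (simp add: half_plane_def)

text \<open>The inner product with the radial unit vector recovers \<open>f\<close> from
  \<open>v\<close> on the unit circle. This is how smoothness passes from the velocity to the
  profile.\<close>

lemma f_eq:
  assumes "t \<in> {-pi/2<..<pi/2}"
  shows "f t = s * cos t * v (vector [s * cos t, s * sin t]) $ 1 + s * sin t * v (vector [s * cos t, s * sin t]) $ 2"
proof -
  have "v (polar s 1 t) = (f t / 1) *\<^sub>R polar s 1 t"
    using rad assms unfolding radial_field_def by force
  then have v: "v (vector [s * cos t, s * sin t]) = f t *\<^sub>R vector [s * cos t, s * sin t]"
    by (simp add: polar_eq)
  have ss: "s * s = 1" using s by auto
  have "f t = s * cos t * (f t * (s * cos t)) + s * sin t * (f t * (s * sin t))"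
  proof -
    have "s * cos t * (f t * (s * cos t)) + s * sin t * (f t * (s * sin t)) =
        (s * s) * f t * ((cos t)\<^sup>2 + (sin t)\<^sup>2)"
      by (simp only: power2_eq_square distrib_left distrib_right mult_ac)
    then show ?thesis unfolding ss by simp
  qed
  then show ?thesis unfolding v by (simp only: vector_scaleR_component vector_2 real_scaleR_def)
qed

lemma f_C2:
  obtains f1 f2 where
    "\<And>t. t \<in> {-pi/2<..<pi/2} \<Longrightarrow> (f has_real_derivative f1 t) (at t)"
    "\<And>t. t \<in> {-pi/2<..<pi/2} \<Longrightarrow> (f1 has_real_derivative f2 t) (at t)"
proof -
  let ?I = "{-pi/2<..<pi/2}"
  define \<gamma> :: "real \<Rightarrow> real^2" where "\<gamma> t = vector [s * cos t, s * sin t]" for t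
  have \<gamma>: "\<gamma> t \<in> half_plane s" if "t \<in> ?I" for t
    using polar_in_half_plane[OF s _ that, of 1] by (simp add: polar_eq \<gamma>_def)
  have chain: "((\<lambda>t. g (\<gamma> t)) has_real_derivative - (s * sin t) * pd 1 g (\<gamma> t) + s * cos t * pd 2 g (\<gamma> t)) (at t)"
    if "g differentiable (at (\<gamma> t))" for g t
    unfolding \<gamma>_def
    by (rule has_real_derivative_along_curve) (use that in \<open>auto simp: \<gamma>_def intro!: derivative_eq_intros\<close>)
  define V where "V i t = v (\<gamma> t) $ i" for i t
  define V1 where "V1 i t = - (s * sin t) * pd 1 (\<lambda>y. v y $ i) (\<gamma> t) + s * cos t * pd 2 (\<lambda>y. v y $ i) (\<gamma> t)" for i t
  have V: "(V i has_real_derivative V1 i t) (at t)" if "t \<in> ?I" for i t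
    unfolding V_def V1_def using chain[OF v_diff[OF \<gamma>[OF that]]] .
  have "\<exists>D. (V1 i has_real_derivative D) (at t)" if "t \<in> ?I" for i t
    unfolding V1_def
    by (rule exI, (rule derivative_eq_intros chain[OF pd_v_diff[OF \<gamma>[OF that]]] refl)+)
  then have V1: "(V1 i has_real_derivative deriv (V1 i) t) (at t)" if "t \<in> ?I" for i t
    using that DERIV_deriv_iff_has_field_derivative by blast
  define f1 where "f1 t = s * cos t * V1 1 t - s * sin t * V 1 t + s * sin t * V1 2 t + s * cos t * V 2 t" for t
  have f_V: "s * cos t * V 1 t + s * sin t * V 2 t = f t" if "t \<in> ?I" for t
    using f_eq[OF that] by (simp add: V_def \<gamma>_def)
  have "(f has_real_derivative f1 t) (at t)" if t: "t \<in> ?I" for t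
  proof (rule has_field_derivative_transform_within_open[OF _ _ t f_V])
    show "((\<lambda>t. s * cos t * V 1 t + s * sin t * V 2 t) has_real_derivative f1 t) (at t)"
      by (rule derivative_eq_intros V[OF t] refl | simp add: f1_def algebra_simps)+
  qed auto
  moreover have "\<exists>D. (f1 has_real_derivative D) (at t)" if t: "t \<in> ?I" for t
    unfolding f1_def
    by (rule exI, (rule derivative_eq_intros V[OF t] V1[OF t] refl)+)
  then have "(f1 has_real_derivative deriv f1 t) (at t)" if "t \<in> ?I" for t
    using that DERIV_deriv_iff_has_field_derivative by blast
  ultimately show ?thesis using that by blast
qed

lemma arctan_derivs:
  fixes g :: "real \<Rightarrow> real"
  assumes g: "\<And>t. t \<in> {-pi/2<..<pi/2} \<Longrightarrow> (g has_real_derivative g1 t) (at t)" and a: "a \<noteq> 0"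
  shows "((\<lambda>x. g (arctan (b / x))) has_real_derivative - b / (a\<^sup>2 + b\<^sup>2) * g1 (arctan (b / a))) (at a)"
    and "((\<lambda>y. g (arctan (y / a))) has_real_derivative a / (a\<^sup>2 + b\<^sup>2) * g1 (arctan (b / a))) (at b)"
proof -
  have I: "arctan c \<in> {-pi/2<..<pi/2}" for c using arctan_bounded[of c] by auto
  have nz: "a\<^sup>2 + b\<^sup>2 \<noteq> 0" "1 + (b / a)\<^sup>2 \<noteq> 0"
    using a by (auto simp: sum_power2_eq_zero_iff) (metis add_pos_nonneg less_irrefl zero_le_power2 zero_less_one power_divide)
  have "((\<lambda>x. arctan (b / x)) has_real_derivative - b / (a\<^sup>2 + b\<^sup>2)) (at a)"
    using a nz by (auto intro!: derivative_eq_intros simp: field_simps power2_eq_square)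
  from DERIV_chain'[OF this g[OF I]]
  show "((\<lambda>x. g (arctan (b / x))) has_real_derivative - b / (a\<^sup>2 + b\<^sup>2) * g1 (arctan (b / a))) (at a)"
    by (simp add: mult_ac)
  have "((\<lambda>y. arctan (y / a)) has_real_derivative a / (a\<^sup>2 + b\<^sup>2)) (at b)"
    using a nz by (auto intro!: derivative_eq_intros simp: field_simps power2_eq_square)
  from DERIV_chain'[OF this g[OF I]]
  show "((\<lambda>y. g (arctan (y / a))) has_real_derivative a / (a\<^sup>2 + b\<^sup>2) * g1 (arctan (b / a))) (at b)"
    by (simp add: mult_ac)
qed

lemma v_cartesian:
  assumes "0 < s * a"
  shows "v (vector [a, b]) $ 1 = f (arctan (b / a)) * (a / (a\<^sup>2 + b\<^sup>2))"
    and "v (vector [a, b]) $ 2 = f (arctan (b / a)) * (b / (a\<^sup>2 + b\<^sup>2))"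
  using radial_field_cartesian[OF s assms rad, of b] by simp_all

section \<open>Reduction of the momentum equation to the profile equation\<close>

context
  fixes f1 f2 :: "real \<Rightarrow> real"
  assumes f1: "\<And>t. t \<in> {-pi/2<..<pi/2} \<Longrightarrow> (f has_real_derivative f1 t) (at t)"
    and f2: "\<And>t. t \<in> {-pi/2<..<pi/2} \<Longrightarrow> (f1 has_real_derivative f2 t) (at t)"
begin

lemma pd_v:
  fixes a b :: real
  assumes a: "0 < s * a"
  defines "F \<equiv> f (arctan (b / a))" and "F1 \<equiv> f1 (arctan (b / a))"
  shows "pd 1 (\<lambda>y. v y $ 1) (vector [a, b]) = (F * (b\<^sup>2 - a\<^sup>2) - F1 * (a * b)) / (a\<^sup>2 + b\<^sup>2)\<^sup>2"
    and "pd 2 (\<lambda>y. v y $ 1) (vector [a, b]) = (F1 * a\<^sup>2 - 2 * F * (a * b)) / (a\<^sup>2 + b\<^sup>2)\<^sup>2"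
    and "pd 1 (\<lambda>y. v y $ 2) (vector [a, b]) = (- F1 * b\<^sup>2 - 2 * F * (a * b)) / (a\<^sup>2 + b\<^sup>2)\<^sup>2"
    and "pd 2 (\<lambda>y. v y $ 2) (vector [a, b]) = (F1 * (a * b) + F * (a\<^sup>2 - b\<^sup>2)) / (a\<^sup>2 + b\<^sup>2)\<^sup>2"
proof -
  have a0: "a \<noteq> 0" and nz: "a\<^sup>2 + b\<^sup>2 \<noteq> 0" using a by (auto simp: sum_power2_eq_zero_iff)
  define N where "N = a\<^sup>2 + b\<^sup>2"
  have N: "N \<noteq> 0" using nz by (simp add: N_def)
  note dv = v_diff[OF iffD2[OF vector_in_half_plane a]]
  note 1 = pd_1_eqI[OF a dv v_cartesian(1)] pd_1_eqI[OF a dv v_cartesian(2)]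
  note 2 = pd_2_eqI[OF dv v_cartesian(1)[OF a]] pd_2_eqI[OF dv v_cartesian(2)[OF a]]
  note der = DERIV_ident DERIV_const arctan_derivs[OF f1 a0] DERIV_add DERIV_diff DERIV_minus DERIV_mult
    DERIV_divide DERIV_power nz
  show "pd 1 (\<lambda>y. v y $ 1) (vector [a, b]) = (F * (b\<^sup>2 - a\<^sup>2) - F1 * (a * b)) / (a\<^sup>2 + b\<^sup>2)\<^sup>2"
    by (rule 1, assumption, rule DERIV_cong, (rule der | assumption)+)
       (use N in \<open>simp flip: F_def F1_def N_def, simp add: field_simps, simp add: N_def power2_eq_square power3_eq_cube power4_eq_xxxx algebra_simps\<close>)
  show "pd 2 (\<lambda>y. v y $ 1) (vector [a, b]) = (F1 * a\<^sup>2 - 2 * F * (a * b)) / (a\<^sup>2 + b\<^sup>2)\<^sup>2"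
    by (rule 2, rule DERIV_cong, (rule der | assumption)+)
       (use N in \<open>simp flip: F_def F1_def N_def, simp add: field_simps, simp add: N_def power2_eq_square power3_eq_cube power4_eq_xxxx algebra_simps\<close>)
  show "pd 1 (\<lambda>y. v y $ 2) (vector [a, b]) = (- F1 * b\<^sup>2 - 2 * F * (a * b)) / (a\<^sup>2 + b\<^sup>2)\<^sup>2"
    by (rule 1, assumption, rule DERIV_cong, (rule der | assumption)+)
       (use N in \<open>simp flip: F_def F1_def N_def, simp add: field_simps, simp add: N_def power2_eq_square power3_eq_cube power4_eq_xxxx algebra_simps\<close>)
  show "pd 2 (\<lambda>y. v y $ 2) (vector [a, b]) = (F1 * (a * b) + F * (a\<^sup>2 - b\<^sup>2)) / (a\<^sup>2 + b\<^sup>2)\<^sup>2"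
    by (rule 2, rule DERIV_cong, (rule der | assumption)+)
       (use N in \<open>simp flip: F_def F1_def N_def, simp add: field_simps, simp add: N_def power2_eq_square power3_eq_cube power4_eq_xxxx algebra_simps\<close>)
qed

text \<open>The momentum equation solved for the pressure gradient. Its radial part is
  \<open>(F2 + F\<^sup>2) / r^3\<close> and its angular part \<open>2 * F1 / r^3\<close>; the two
  formulas are their Cartesian components.\<close>

lemma pd_p:
  fixes a b :: real
  assumes a: "0 < s * a"
  defines "F \<equiv> f (arctan (b / a))" and "F1 \<equiv> f1 (arctan (b / a))" and "F2 \<equiv> f2 (arctan (b / a))"
  shows "pd 1 p (vector [a, b]) = ((F2 + F\<^sup>2) * a - 2 * F1 * b) / (a\<^sup>2 + b\<^sup>2)\<^sup>2"
    and "pd 2 p (vector [a, b]) = ((F2 + F\<^sup>2) * b + 2 * F1 * a) / (a\<^sup>2 + b\<^sup>2)\<^sup>2"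
proof -
  have a0: "a \<noteq> 0" and nz: "a\<^sup>2 + b\<^sup>2 \<noteq> 0" using a by (auto simp: sum_power2_eq_zero_iff)
  note mem = iffD2[OF vector_in_half_plane a]
  note dv = pd_v_diff[OF mem]
  have nz2: "(a\<^sup>2 + b\<^sup>2)\<^sup>2 \<noteq> 0" using nz by simp
  note der = DERIV_ident DERIV_const arctan_derivs[OF f1 a0] arctan_derivs[OF f2 a0] DERIV_add DERIV_diff
    DERIV_minus DERIV_mult DERIV_divide DERIV_power nz2
  define N where "N = a\<^sup>2 + b\<^sup>2"
  have N: "N \<noteq> 0" "b\<^sup>2 = N - a\<^sup>2" using nz by (simp_all add: N_def)
  have lap11: "pd 1 (pd 1 (\<lambda>y. v y $ 1)) (vector [a, b]) =
     (F2 * a * b\<^sup>2 - F1 * b * (b\<^sup>2 - a\<^sup>2) - (2 * a * F + F1 * b) * N - 4 * a * (F * (b\<^sup>2 - a\<^sup>2) - F1 * (a * b))) / N^3"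
    by (rule pd_1_eqI[OF a dv pd_v(1)], assumption, rule DERIV_cong, (rule der | assumption)+)
       (use N(1) in \<open>simp flip: F_def F1_def F2_def N_def, simp add: field_simps power2_eq_square power3_eq_cube power4_eq_xxxx\<close>)
  have lap12: "pd 2 (pd 2 (\<lambda>y. v y $ 1)) (vector [a, b]) =
     (F2 * a^3 - 2 * F1 * a\<^sup>2 * b - 2 * F * a * N - 4 * b * (F1 * a\<^sup>2 - 2 * F * (a * b))) / N^3"
    by (rule pd_2_eqI[OF dv pd_v(2)[OF a]], rule DERIV_cong, (rule der | assumption)+)
       (use N(1) in \<open>simp flip: F_def F1_def F2_def N_def, simp add: field_simps power2_eq_square power3_eq_cube power4_eq_xxxx\<close>)
  have lap21: "pd 1 (pd 1 (\<lambda>y. v y $ 2)) (vector [a, b]) =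
     (F2 * b^3 + 2 * F1 * a * b\<^sup>2 - 2 * F * b * N - 4 * a * (- F1 * b\<^sup>2 - 2 * F * (a * b))) / N^3"
    by (rule pd_1_eqI[OF a dv pd_v(3)], assumption, rule DERIV_cong, (rule der | assumption)+)
       (use N(1) in \<open>simp flip: F_def F1_def F2_def N_def, simp add: field_simps power2_eq_square power3_eq_cube power4_eq_xxxx\<close>)
  have lap22: "pd 2 (pd 2 (\<lambda>y. v y $ 2)) (vector [a, b]) =
     (F2 * a\<^sup>2 * b + F1 * a * (a\<^sup>2 - b\<^sup>2) + (F1 * a - 2 * b * F) * N - 4 * b * (F1 * (a * b) + F * (a\<^sup>2 - b\<^sup>2))) / N^3"
    by (rule pd_2_eqI[OF dv pd_v(4)[OF a]], rule DERIV_cong, (rule der | assumption)+)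
       (use N(1) in \<open>simp flip: F_def F1_def F2_def N_def, simp add: field_simps power2_eq_square power3_eq_cube power4_eq_xxxx\<close>)
  have mom: "pd i p (vector [a, b]) =
      (pd 1 (pd 1 (\<lambda>y. v y $ i)) (vector [a, b]) + pd 2 (pd 2 (\<lambda>y. v y $ i)) (vector [a, b]))
      - (F * (a / N) * pd 1 (\<lambda>y. v y $ i) (vector [a, b]) + F * (b / N) * pd 2 (\<lambda>y. v y $ i) (vector [a, b]))" for i
  proof -
    have "- (\<Sum>j\<in>UNIV. pd j (pd j (\<lambda>y. v y $ i)) (vector [a, b]))
        + (\<Sum>j\<in>UNIV. v (vector [a, b]) $ j * pd j (\<lambda>y. v y $ i) (vector [a, b]))
        + pd i p (vector [a, b]) = 0"
      using ns mem unfolding navier_stokes_def by blast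
    then show ?thesis unfolding sum_2 v_cartesian[OF a] F_def N_def by linarith
  qed
  have pdv: "pd 1 (\<lambda>y. v y $ 1) (vector [a, b]) = (F * (b\<^sup>2 - a\<^sup>2) - F1 * (a * b)) / N\<^sup>2"
    "pd 2 (\<lambda>y. v y $ 1) (vector [a, b]) = (F1 * a\<^sup>2 - 2 * F * (a * b)) / N\<^sup>2"
    "pd 1 (\<lambda>y. v y $ 2) (vector [a, b]) = (- F1 * b\<^sup>2 - 2 * F * (a * b)) / N\<^sup>2"
    "pd 2 (\<lambda>y. v y $ 2) (vector [a, b]) = (F1 * (a * b) + F * (a\<^sup>2 - b\<^sup>2)) / N\<^sup>2"
    unfolding F_def F1_def N_def by (rule pd_v[OF a])+
  \<comment> \<open>Viscous and convective terms share the denominator \<open>N^3\<close>, while the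
    gradient has \<open>N\<^sup>2\<close>: the numerator must contain a factor \<open>N\<close>, and
    this divisibility is the only identity left to check.\<close>
  have combine: "(A / N^3 + B / N^3) - (F * (a / N) * (X / N\<^sup>2) + F * (b / N) * (Y / N\<^sup>2)) = Z / N\<^sup>2"
    if "A + B - F * (a * X + b * Y) = Z * N" for A B X Y Z
  proof -
    have "(A / N^3 + B / N^3) - (F * (a / N) * (X / N\<^sup>2) + F * (b / N) * (Y / N\<^sup>2))
        = (A + B - F * (a * X + b * Y)) / N^3"
      by (simp add: power2_eq_square power3_eq_cube diff_divide_distrib add_divide_distrib algebra_simps)
    then show ?thesis using N(1) by (simp add: that power2_eq_square power3_eq_cube)
  qed
  have "pd 1 p (vector [a, b]) = ((F2 + F\<^sup>2) * a - 2 * F1 * b) / N\<^sup>2"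
    unfolding mom lap11 lap12 pdv
    by (rule combine) (simp add: N_def power2_eq_square power3_eq_cube algebra_simps)
  then show "pd 1 p (vector [a, b]) = ((F2 + F\<^sup>2) * a - 2 * F1 * b) / (a\<^sup>2 + b\<^sup>2)\<^sup>2" unfolding N_def .
  have "pd 2 p (vector [a, b]) = ((F2 + F\<^sup>2) * b + 2 * F1 * a) / N\<^sup>2"
    unfolding mom lap21 lap22 pdv
    by (rule combine) (simp add: N_def power2_eq_square power3_eq_cube algebra_simps)
  then show "pd 2 p (vector [a, b]) = ((F2 + F\<^sup>2) * b + 2 * F1 * a) / (a\<^sup>2 + b\<^sup>2)\<^sup>2" unfolding N_def .
qed

text \<open>The angular derivative of the pressure is exactly that of
  \<open>2 * f t / r\<^sup>2\<close>. After subtraction nothing depends on the angle, so the radial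
  derivative cannot either, and that is the profile equation.\<close>

lemma p_polar_derivs:
  assumes r: "0 < r" and t: "t \<in> {-pi/2<..<pi/2}"
  shows "((\<lambda>t. p (polar s r t) - 2 * f t / r\<^sup>2) has_real_derivative 0) (at t)"
    and "((\<lambda>r. p (polar s r t) - 2 * f t / r\<^sup>2) has_real_derivative
           (f2 t + (f t)\<^sup>2 + 4 * f t) / r^3) (at r)"
proof -
  let ?a = "s * r * cos t" and ?b = "s * r * sin t"
  have c: "cos t > 0" using t by (intro cos_gt_zero_pi) auto
  have a: "0 < s * ?a" using s r c by auto
  have ss: "s * s = 1" using s by auto
  have "?b / ?a = tan t" using a r by (auto simp: tan_def)
  then have at: "arctan (?b / ?a) = t" using t by (simp add: arctan_tan)
  have "?a\<^sup>2 + ?b\<^sup>2 = (s * s) * r\<^sup>2 * ((cos t)\<^sup>2 + (sin t)\<^sup>2)"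
    by (simp only: power2_eq_square distrib_left distrib_right mult_ac)
  then have N: "?a\<^sup>2 + ?b\<^sup>2 = r\<^sup>2" unfolding ss by simp
  note pd = pd_p[OF a, of ?b, unfolded at N]
  have r0: "r \<noteq> 0" using r by simp
  have dp: "p differentiable (at (vector [?a, ?b]))" using p_diff vector_in_half_plane a by blast
  have "((\<lambda>t. p (vector [s * r * cos t, s * r * sin t])) has_real_derivative
      (s * r * - sin t) * pd 1 p (vector [?a, ?b]) + (s * r * cos t) * pd 2 p (vector [?a, ?b])) (at t)"
    by (rule has_real_derivative_along_curve[where \<alpha> = "\<lambda>t. s * r * cos t" and \<beta> = "\<lambda>t. s * r * sin t"])
       (use dp in \<open>auto intro!: derivative_eq_intros\<close>)
  moreover have "(s * r * - sin t) * pd 1 p (vector [?a, ?b]) + (s * r * cos t) * pd 2 p (vector [?a, ?b]) = 2 * f1 t / r\<^sup>2"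
  proof -
    have "(s * r * - sin t) * pd 1 p (vector [?a, ?b]) + (s * r * cos t) * pd 2 p (vector [?a, ?b])
        = 2 * f1 t * (?a\<^sup>2 + ?b\<^sup>2) / (r\<^sup>2)\<^sup>2"
      unfolding pd using r0 by (simp add: field_simps) (simp add: power2_eq_square algebra_simps)
    then show ?thesis unfolding N using r0 by (simp add: power2_eq_square)
  qed
  ultimately have "((\<lambda>t. p (polar s r t)) has_real_derivative 2 * f1 t / r\<^sup>2) (at t)"
    by (simp add: polar_eq)
  from DERIV_diff[OF this DERIV_cdivide[OF DERIV_cmult[OF f1[OF t], of 2], of "r\<^sup>2"]]
  show "((\<lambda>t. p (polar s r t) - 2 * f t / r\<^sup>2) has_real_derivative 0) (at t)"
    by simp
  have "((\<lambda>r. p (vector [s * r * cos t, s * r * sin t])) has_real_derivative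
      (s * cos t) * pd 1 p (vector [?a, ?b]) + (s * sin t) * pd 2 p (vector [?a, ?b])) (at r)"
    by (rule has_real_derivative_along_curve[where \<alpha> = "\<lambda>r. s * r * cos t" and \<beta> = "\<lambda>r. s * r * sin t"])
       (use dp in \<open>auto intro!: derivative_eq_intros\<close>)
  moreover have "(s * cos t) * pd 1 p (vector [?a, ?b]) + (s * sin t) * pd 2 p (vector [?a, ?b])
      = (f2 t + (f t)\<^sup>2) / r^3"
  proof -
    \<comment> \<open>Multiplying by \<open>r\<close> gives the product of the gradient with the
      position vector, in which the \<open>f1\<close> terms cancel.\<close>
    have "r * ((s * cos t) * pd 1 p (vector [?a, ?b]) + (s * sin t) * pd 2 p (vector [?a, ?b]))
        = (f2 t + (f t)\<^sup>2) * (?a\<^sup>2 + ?b\<^sup>2) / (r\<^sup>2)\<^sup>2"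
      unfolding pd using r0 by (simp add: field_simps) (simp add: power2_eq_square algebra_simps)
    moreover have "X = Y / r^3" if "r * X = Y * r\<^sup>2 / (r\<^sup>2)\<^sup>2" for X Y
    proof -
      have "r * X = r * (Y / r^3)" using that r0 by (simp add: power2_eq_square power3_eq_cube)
      then show ?thesis using r0 mult_left_cancel[of r X "Y / r^3"] by blast
    qed
    ultimately show ?thesis unfolding N by blast
  qed
  moreover have "((\<lambda>r. 2 * f t / r\<^sup>2) has_real_derivative - 4 * f t / r^3) (at r)"
    using r0 by (auto intro!: derivative_eq_intros simp: field_simps power2_eq_square power3_eq_cube)
  ultimately have "((\<lambda>r. p (vector [s * r * cos t, s * r * sin t]) - 2 * f t / r\<^sup>2) has_real_derivative
      (f2 t + (f t)\<^sup>2) / r^3 - (- 4 * f t / r^3)) (at r)"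
    using DERIV_diff by fastforce
  then show "((\<lambda>r. p (polar s r t) - 2 * f t / r\<^sup>2) has_real_derivative
           (f2 t + (f t)\<^sup>2 + 4 * f t) / r^3) (at r)"
    by (simp add: polar_eq add_divide_distrib)
qed

lemma p_polar_radial:
  assumes r: "0 < r" and t: "t \<in> {-pi/2<..<pi/2}"
  shows "p (polar s r t) - 2 * f t / r\<^sup>2 = p (polar s r 0) - 2 * f 0 / r\<^sup>2"
  using t
  by (intro DERIV_isconst3[of "-pi/2" "pi/2"] p_polar_derivs(1)[OF r]) auto

lemma profile_ode:
  obtains C k where "\<And>t. t \<in> {-pi/2<..<pi/2} \<Longrightarrow> f2 t = C - 4 * f t - (f t)\<^sup>2"
    "\<And>r t. 0 < r \<Longrightarrow> t \<in> {-pi/2<..<pi/2} \<Longrightarrow> p (polar s r t) = (2 * f t - C / 2) / r\<^sup>2 + k"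
proof
  \<comment> \<open>Independence of the angle lets the constant be read off at angle 0; it then
    equals the corresponding expression at every \<open>t\<close> by comparing radial derivatives at
    radius 1.\<close>
  define C where "C = f2 0 + (f 0)\<^sup>2 + 4 * f 0"
  define g where "g r = p (polar s r 0) - 2 * f 0 / r\<^sup>2" for r
  have g: "(g has_real_derivative C / r^3) (at r)" if "0 < r" for r
    unfolding g_def C_def using that by (intro p_polar_derivs(2)) auto
  show "f2 t = C - 4 * f t - (f t)\<^sup>2" if t: "t \<in> {-pi/2<..<pi/2}" for t
  proof -
    have "((\<lambda>r. p (polar s r t) - 2 * f t / r\<^sup>2) has_real_derivative (f2 t + (f t)\<^sup>2 + 4 * f t) / 1^3) (at 1)"
      by (rule p_polar_derivs(2)[OF _ t]) simp
    then have "(g has_real_derivative (f2 t + (f t)\<^sup>2 + 4 * f t) / 1^3) (at 1)"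
      by (rule has_field_derivative_transform_within_open[where S = "{0<..}"])
         (auto simp: g_def p_polar_radial[OF _ t])
    then show ?thesis using DERIV_unique[OF _ g[of 1]] by fastforce
  qed
  have "((\<lambda>r. g r + C / 2 / r\<^sup>2) has_real_derivative 0) (at r)" if "0 < r" for r
  proof -
    have "((\<lambda>r. C / 2 / r\<^sup>2) has_real_derivative - C / r^3) (at r)"
      using that by (auto intro!: derivative_eq_intros simp: field_simps power2_eq_square power3_eq_cube)
    from DERIV_add[OF g[OF that] this] show ?thesis by simp
  qed
  \<comment> \<open>The interval from 0 to \<open>r + 2\<close> contains both \<open>r\<close> and
    the reference radius 1.\<close>
  then have const: "g r + C / 2 / r\<^sup>2 = g 1 + C / 2 / 1\<^sup>2" if "0 < r" for r
    using that by (intro DERIV_isconst3[of 0 "r + 2"]) auto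
  show "p (polar s r t) = (2 * f t - C / 2) / r\<^sup>2 + (g 1 + C / 2)"
    if "0 < r" "t \<in> {-pi/2<..<pi/2}" for r t
  proof -
    have "p (polar s r t) - 2 * f t / r\<^sup>2 = g r" using p_polar_radial[OF that] by (simp add: g_def)
    then show ?thesis using const[OF that(1)] by (simp add: diff_divide_distrib)
  qed
qed

end

end

section \<open>Types of Jeffery--Hamel solutions\<close>

lemma closure_half_plane:
  assumes "s = 1 \<or> s = -1"
  shows "closure (half_plane s) = {x. 0 \<le> s * x $ 1}"
proof -
  have "half_plane s = (if s = 1 then {x. x $ 1 > 0} else {x. x $ 1 < 0})"
    using assms by (auto simp: half_plane_def)
  then show ?thesis using assms by auto
qed

lemma open_half_plane: "open (half_plane s)"
  unfolding half_plane_def by (intro open_Collect_less continuous_intros)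

lemma frontier_half_plane:
  assumes "s = 1 \<or> s = -1"
  shows "frontier (half_plane s) = {x. x $ 1 = 0}"
  using assms unfolding frontier_def closure_half_plane[OF assms] interior_open[OF open_half_plane]
  by (auto simp: half_plane_def)

lemma norm_real_2: "(norm (x :: real^2))\<^sup>2 = (x $ 1)\<^sup>2 + (x $ 2)\<^sup>2"
  by (simp add: norm_vec_def L2_set_def sum_2)

text \<open>Unlike the arctangent of the quotient of coordinates, this angle is defined and
  continuous up to the boundary line, which continuity on the closed half-plane requires.\<close>

lemma polar_arcsin:
  assumes "s = 1 \<or> s = -1" "0 \<le> s * x $ 1" "x \<noteq> 0"
  shows "-1 \<le> s * x $ 2 / norm x \<and> s * x $ 2 / norm x \<le> 1"
    and "arcsin (s * x $ 2 / norm x) \<in> {-pi/2..pi/2}"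
    and "x = polar s (norm x) (arcsin (s * x $ 2 / norm x))"
proof -
  let ?y = "s * x $ 2 / norm x"
  have ss: "s\<^sup>2 = 1" "\<bar>s\<bar> = 1" using assms by auto
  have x: "norm x > 0" using assms by simp
  have "\<bar>?y\<bar> \<le> 1"
    using component_le_norm_cart[of x 2] x ss by (simp add: abs_mult)
  then have y: "-1 \<le> ?y" "?y \<le> 1" unfolding abs_le_iff by linarith+
  then show "-1 \<le> ?y \<and> ?y \<le> 1" by blast
  show "arcsin ?y \<in> {-pi/2..pi/2}" using arcsin_bounded[OF y] by simp
  have "1 - ?y\<^sup>2 = ((norm x)\<^sup>2 - (x $ 2)\<^sup>2) / (norm x)\<^sup>2"
    using x ss by (simp add: power_divide power_mult_distrib diff_divide_distrib)
  also have "\<dots> = (s * x $ 1 / norm x)\<^sup>2"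
    unfolding norm_real_2[of x] using ss by (simp add: power_divide power_mult_distrib norm_real_2)
  finally have "cos (arcsin ?y) = s * x $ 1 / norm x"
    using y x assms(2) by (simp add: cos_arcsin)
  moreover have "sin (arcsin ?y) = ?y" using y by (intro sin_arcsin)
  ultimately show "x = polar s (norm x) (arcsin ?y)"
    using x assms(1) by (auto simp: polar_eq vec_eq_iff forall_2)
qed

lemma radial_field_closure:
  assumes s: "s = 1 \<or> s = -1" and v: "radial_field s f v" and x: "0 \<le> s * x $ 1" "x \<noteq> 0"
  shows "v x = (f (arcsin (s * x $ 2 / norm x)) / (norm x)\<^sup>2) *\<^sub>R x"
proof -
  define \<theta> where "\<theta> = arcsin (s * x $ 2 / norm x)"
  define r where "r = norm x"
  have r: "0 < r" and xp: "x = polar s r \<theta>"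
    using polar_arcsin(3)[OF s x] x by (simp_all add: r_def \<theta>_def)
  have "\<theta> \<in> {-pi/2..pi/2}"
    unfolding \<theta>_def by (rule polar_arcsin(2)[OF s x])
  with v r have "v (polar s r \<theta>) = (f \<theta> / r) *\<^sub>R polar s 1 \<theta>"
    unfolding radial_field_def by blast
  also have "\<dots> = (f \<theta> / r\<^sup>2) *\<^sub>R polar s r \<theta>"
    using r by (simp add: polar_def power2_eq_square)
  finally have "v x = (f \<theta> / r\<^sup>2) *\<^sub>R x" using xp by simp
  then show ?thesis by (simp add: \<theta>_def r_def)
qed

lemma radial_field_continuous:
  assumes s: "s = 1 \<or> s = -1" and v: "radial_field s f v" and f: "continuous_on {-pi/2..pi/2} f"
  shows "continuous_on (closure (half_plane s) - {0}) v"
proof -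
  let ?S = "closure (half_plane s) - {0}"
  have S: "x \<in> ?S \<longleftrightarrow> 0 \<le> s * x $ 1 \<and> x \<noteq> 0" for x
    by (simp add: closure_half_plane[OF s])
  have "continuous_on ?S (\<lambda>x. arcsin (s * x $ 2 / norm x))"
  proof (intro continuous_intros ballI)
    show "norm x \<noteq> 0" if "x \<in> ?S" for x using that by simp
    show "-1 \<le> s * x $ 2 / norm x \<and> s * x $ 2 / norm x \<le> 1" if "x \<in> ?S" for x
      using polar_arcsin(1)[OF s] that S by blast
  qed
  moreover have "(\<lambda>x. arcsin (s * x $ 2 / norm x)) ` ?S \<subseteq> {-pi/2..pi/2}"
    using polar_arcsin(2)[OF s] S by blast
  ultimately have "continuous_on ?S (\<lambda>x. f (arcsin (s * x $ 2 / norm x)))"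
    by (rule continuous_on_compose2[OF f])
  then have "continuous_on ?S (\<lambda>x. (f (arcsin (s * x $ 2 / norm x)) / (norm x)\<^sup>2) *\<^sub>R x)"
    by (intro continuous_intros) auto
  then show ?thesis
    by (rule continuous_on_eq) (metis S radial_field_closure[OF s v])
qed

lemma radial_field_boundary:
  assumes s: "s = 1 \<or> s = -1" and v: "radial_field s f v" and f: "f (-pi/2) = 0" "f (pi/2) = 0"
    and x: "x \<in> frontier (half_plane s) - {0}"
  shows "v x = 0"
proof -
  have x1: "x $ 1 = 0" and x0: "x \<noteq> 0" using x by (auto simp: frontier_half_plane[OF s])
  have "norm x = \<bar>x $ 2\<bar>" using x1 by (simp add: norm_vec_def L2_set_def sum_2)
  moreover have "x $ 2 \<noteq> 0" using x0 x1 by (auto simp: vec_eq_iff forall_2)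
  ultimately have "s * x $ 2 / norm x = 1 \<or> s * x $ 2 / norm x = -1"
    using s by (auto simp: abs_if)
  then show ?thesis
    using radial_field_closure[OF s v _ x0] x1 f by (auto simp: arcsin_1 arcsin_minus_1)
qed

text \<open>Self-similarity asks for a pressure homogeneous of degree -2, whereas a Jeffery--Hamel
  field comes with some pressure; the two differ by a constant.\<close>

lemma navier_stokes_add_const:
  assumes "navier_stokes S u p"
  shows "navier_stokes S u (\<lambda>x. p x - k)"
proof -
  have p: "p differentiable (at x)" if "x \<in> S" for x
    using assms that by (simp add: navier_stokes_def)
  have "pd i (\<lambda>x. p x - k) x = pd i p x" if "x \<in> S" for i x
  proof -
    have "(p has_derivative frechet_derivative p (at x)) (at x)"
      using p[OF that] frechet_derivative_works by blast
    from has_derivative_diff[OF this has_derivative_const[of k]]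
    have "((\<lambda>x. p x - k) has_derivative frechet_derivative p (at x)) (at x)" by simp
    from frechet_derivative_at[OF this] show ?thesis by (simp add: pd_def)
  qed
  moreover from this have "Ck_on 1 (\<lambda>x. p x - k) S"
    using assms p by (auto simp: navier_stokes_def cong: continuous_on_cong)
  ultimately show ?thesis using assms by (auto simp: navier_stokes_def)
qed

lemma jeffery_hamel_type:
  assumes s: "s = 1 \<or> s = -1" and jh: "jeffery_hamel s \<Psi> v"
    and small: "\<bar>\<Psi>\<bar> \<le> 1/100000" and nonzero: "\<Psi> \<noteq> 0"
  shows "self_similar_of_type s v (if 0 < \<Psi> then (1, 2) else (0, 1))"
proof -
  obtain p f where ns: "navier_stokes (half_plane s) v p" and rad: "radial_field s f v"
    and cont: "continuous_on {-pi/2..pi/2} f" and flux: "(f has_integral \<Psi>) {-pi/2..pi/2}"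
    and walls: "f (-pi/2) = 0" "f (pi/2) = 0"
    and even: "\<And>t. t \<in> {-pi/2..pi/2} \<Longrightarrow> f (-t) = f t"
    and bound: "\<And>t. t \<in> {-pi/2..pi/2} \<Longrightarrow> \<bar>f t\<bar> \<le> 6 * \<bar>\<Psi>\<bar>"
    using jh unfolding jeffery_hamel_def by blast
  interpret radial_flow s f v p by unfold_locales fact+
  obtain f1 f2 where f1: "\<And>t. t \<in> {-pi/2<..<pi/2} \<Longrightarrow> (f has_real_derivative f1 t) (at t)"
    and f2: "\<And>t. t \<in> {-pi/2<..<pi/2} \<Longrightarrow> (f1 has_real_derivative f2 t) (at t)"
    using f_C2 by blast
  obtain C k where ode: "\<And>t. t \<in> {-pi/2<..<pi/2} \<Longrightarrow> f2 t = C - 4 * f t - (f t)\<^sup>2"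
    and p: "\<And>r t. 0 < r \<Longrightarrow> t \<in> {-pi/2<..<pi/2} \<Longrightarrow> p (polar s r t) = (2 * f t - C / 2) / r\<^sup>2 + k"
    using profile_ode[OF f1 f2] by blast
  have f2': "(f1 has_real_derivative C - 4 * f t - (f t)\<^sup>2) (at t)" if "t \<in> {-pi/2<..<pi/2}" for t
    using f2[OF that] unfolding ode[OF that] .
  interpret small_profile f f1 C \<Psi>
    by unfold_locales (fact cont f1 f2' even walls(2) bound flux small nonzero)+
  have self_similar: "self_similar_solution s v (\<lambda>x. p x - k)"
    unfolding self_similar_solution_def
  proof (intro conjI allI impI ballI)
    fix l :: real and x assume l: "0 < l" and x: "x \<in> half_plane s"
    show "v x = l *\<^sub>R v (l *\<^sub>R x)" by (rule radial_field_homogeneous[OF s rad l x])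
    obtain r t where r: "0 < r" "t \<in> {-pi/2<..<pi/2}" "x = polar s r t"
      using polar_inverse[OF s] x unfolding half_plane_def by blast
    have lx: "l *\<^sub>R x = polar s (l * r) t" by (simp add: r(3) polar_def mult_ac)
    have "p (l *\<^sub>R x) - k = (2 * f t - C / 2) / (l * r)\<^sup>2" "p x - k = (2 * f t - C / 2) / r\<^sup>2"
      unfolding lx unfolding r(3) using p r l by simp_all
    then show "p x - k = l\<^sup>2 * (p (l *\<^sub>R x) - k)"
      using l by (simp add: power_mult_distrib)
  qed (fact navier_stokes_add_const[OF ns] radial_field_continuous[OF s rad cont]
        radial_field_boundary[OF s rad walls])+
  have nontrivial: "\<exists>t \<in> {-pi/2<..<pi/2}. f t \<noteq> 0"
    using core_pos[of 0] core_neg[of 0] nonzero by (intro bexI[of _ 0]) (auto simp: neq_iff)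
  define P N where "P = components {t \<in> {-pi/2<..<pi/2}. f t > 0}"
    and "N = components {t \<in> {-pi/2<..<pi/2}. f t < 0}"
  have counts: "finite P \<and> finite N \<and> card P = fst (if 0 < \<Psi> then (1, 2) else (0, 1))
      \<and> card N = snd (if 0 < \<Psi> then (1, 2) else (0, 1 :: nat))"
  proof (cases "0 < \<Psi>")
    case True
    obtain a where a: "0 < a" "a < pi/2" "P = {{-a<..<a}}" "N = {{-pi/2<..<-a}, {a<..<pi/2}}"
      using positive_flux_components[OF True] unfolding P_def N_def by blast
    \<comment> \<open>The midpoint witnesses that the two outer intervals differ, so that they count
      as 2.\<close>
    have "(a + pi/2) / 2 \<in> {a<..<pi/2}" "(a + pi/2) / 2 \<notin> {-pi/2<..<-a}"
      using a(1,2) by auto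
    then have "{-pi/2<..<-a} \<noteq> {a<..<pi/2}" by metis
    then show ?thesis using a True by simp
  next
    case False
    then show ?thesis
      using negative_flux_components nonzero unfolding P_def[symmetric] N_def[symmetric] by simp
  qed
  note counts = counts[unfolded P_def N_def]
  show ?thesis
    unfolding self_similar_of_type_def
    by (intro conjI exI[of _ "\<lambda>x. p x - k"] exI[of _ f])
       (rule self_similar rad walls nontrivial conjunct1[OF counts] conjunct1[OF conjunct2[OF counts]]
         conjunct1[OF conjunct2[OF conjunct2[OF counts]]] conjunct2[OF conjunct2[OF conjunct2[OF counts]]])+
qed

section \<open>The two ends of the aperture flow\<close>

theorem theorem1p4:
  fixes d :: real
  assumes d_pos: "d > 0"
    and gps: "\<exists>\<Phi>1>0. \<forall>\<Phi>. \<bar>\<Phi>\<bar> < \<Phi>1 \<longrightarrow> (\<exists>!u. gps_solution d \<Phi> u)"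
  shows "\<exists>\<Phi>0>0. \<forall>\<Phi>. \<Phi> \<in> {- \<Phi>0 <..< \<Phi>0} \<and> \<Phi> \<noteq> 0 \<longrightarrow>
           (\<exists>!u. gps_solution d \<Phi> u) \<and>
           (\<forall>u. gps_solution d \<Phi> u \<longrightarrow>
             (\<exists>v. leading_order_term d u (upstream \<Phi>) v \<and>
                  self_similar_of_type (upstream \<Phi>) v (0, 1)) \<and>
             (\<exists>v. leading_order_term d u (downstream \<Phi>) v \<and>
                  self_similar_of_type (downstream \<Phi>) v (1, 2)))"
proof -
  obtain \<Phi>1 where \<Phi>1: "\<Phi>1 > 0" "\<And>\<Phi>. \<bar>\<Phi>\<bar> < \<Phi>1 \<Longrightarrow> \<exists>!u. gps_solution d \<Phi> u"
    using gps by blast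
  \<comment> \<open>The flux in the half-plane \<open>s\<close> is \<open>s * \<Phi>\<close>,
    negative upstream and positive downstream for either sign of \<Phi>, so one statement covers all
    four cases.\<close>
  have asymptotics: "\<exists>v. leading_order_term d u s v \<and> self_similar_of_type s v (if 0 < s * \<Phi> then (1, 2) else (0, 1))"
    if u: "gps_solution d \<Phi> u" and \<Phi>: "\<bar>\<Phi>\<bar> \<le> 1/100000" "\<Phi> \<noteq> 0" and s: "s = 1 \<or> s = -1" for \<Phi> u s
  proof -
    have "s \<in> {1, -1}" using s by auto
    then obtain v where jh: "jeffery_hamel s (s * \<Phi>) v"
      and decay: "\<forall>\<sigma> \<in> {0 <..< 1}. \<forall>R > 2 * d. \<exists>c. \<forall>x \<in> half_plane s. norm x > R \<longrightarrow>
           norm x powr (1 + \<sigma>) * norm (u x - v x) \<le> c * \<bar>\<Phi>\<bar>"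
      using u unfolding gps_solution_def by blast
    obtain f where "radial_field s f v" using jh unfolding jeffery_hamel_def by blast
    then have "leading_order_term d u s v"
      unfolding leading_order_term_def using radial_field_homogeneous[OF s] decay by blast
    moreover have "self_similar_of_type s v (if 0 < s * \<Phi> then (1, 2) else (0, 1))"
      by (rule jeffery_hamel_type[OF s jh]) (use s \<Phi> in auto)
    ultimately show ?thesis by blast
  qed
  show ?thesis
  proof (intro exI[of _ "min \<Phi>1 (1/100000)"] conjI allI impI)
    fix \<Phi> u assume \<Phi>: "\<Phi> \<in> {- min \<Phi>1 (1/100000) <..< min \<Phi>1 (1/100000)} \<and> \<Phi> \<noteq> 0"
    then have small: "\<bar>\<Phi>\<bar> < \<Phi>1" "\<bar>\<Phi>\<bar> \<le> 1/100000" "\<Phi> \<noteq> 0" by auto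
    then show "\<exists>!u. gps_solution d \<Phi> u" using \<Phi>1 by blast
    assume u: "gps_solution d \<Phi> u"
    show "\<exists>v. leading_order_term d u (upstream \<Phi>) v \<and> self_similar_of_type (upstream \<Phi>) v (0, 1)"
      using asymptotics[OF u small(2,3), of "upstream \<Phi>"] small(3) by (auto simp: upstream_def split: if_splits)
    show "\<exists>v. leading_order_term d u (downstream \<Phi>) v \<and> self_similar_of_type (downstream \<Phi>) v (1, 2)"
      using asymptotics[OF u small(2,3), of "downstream \<Phi>"] small(3) by (auto simp: downstream_def split: if_splits)
  qed (use \<Phi>1 in auto)
qed

end
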